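(* Let $G\subset \mathbb{C}$ be a simply connected domain such that $0\notin G$. Let $(\lambda_n^{(1)})_n$ and $(\lambda_n^{(2)})_n$ be two sequences of positive integers with $\lim_n\lambda_n^{(1)}=+\infty$ and $\lim_n\dfrac{\lambda_n^{(2)}}{\lambda_n^{(1)}}=+\infty$. Then the sequence of operators $D_n: H(G)\to H(G)\times H(G)$, $D_n(f)=(\widetilde{T}_{\lambda_n^{(1)}}(f), \widetilde{T}_{\lambda_n^{(2)}}(f))$, $n=1,2,\ldots$, is universal.
   Context: $H(G)$ denotes the space of holomorphic functions on $G$ endowed with the topology of uniform convergence on compact subsets of $G$. For $n\in\mathbb{N}$, the operator $\widetilde{T}_n: H(G)\to H(G)$ is defined by $\widetilde{T}_n(f)(\zeta)=\sum_{j=0}^{n}\dfrac{f^{(j)}(\zeta)}{j!}(-\zeta)^j$, $\zeta\in G$. A sequence of continuous linear operators $T_n:X\to Y$, $n=1,2,\ldots$, between topological vector spaces is called universal if there exists $x_0\in X$ such that the set $\{T_nx_0: n\in\mathbb{N}\}$ is dense in $Y$. Products of spaces carry the product topology. *)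

theory Defs
  imports "HOL-Complex_Analysis.Complex_Analysis" "HOL-Library.Function_Algebras"
begin

text \<open>
  A holomorphic function on \<open>G\<close> is represented by its extension by zero to the whole plane,
  so that every element of \<open>H(G)\<close> has exactly one representative and the representatives
  are closed under the pointwise operations on \<open>complex \<Rightarrow> complex\<close>.
\<close>

definition hol_space :: "complex set \<Rightarrow> (complex \<Rightarrow> complex) set" where
  "hol_space G = {f. f holomorphic_on G \<and> (\<forall>z. z \<notin> G \<longrightarrow> f z = 0)}"

definition hol_nbhd :: "complex set \<Rightarrow> (complex \<Rightarrow> complex) \<Rightarrow> complex set \<Rightarrow> real \<Rightarrow> (complex \<Rightarrow> complex) set"
  where "hol_nbhd G f K e = {g \<in> hol_space G. \<forall>z\<in>K. norm (g z - f z) < e}"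

text \<open>The topology of uniform convergence on compact subsets of \<open>G\<close>; see
  \<open>openin_hol_topology\<close> and \<open>limitin_hol_topology\<close> below.\<close>

definition hol_topology :: "complex set \<Rightarrow> (complex \<Rightarrow> complex) topology" where
  "hol_topology G = topology (\<lambda>U. U \<subseteq> hol_space G \<and>
     (\<forall>f\<in>U. \<exists>K e. compact K \<and> K \<subseteq> G \<and> e > 0 \<and> hol_nbhd G f K e \<subseteq> U))"

lemma openin_hol_topology:
  "openin (hol_topology G) U \<longleftrightarrow> U \<subseteq> hol_space G \<and>
     (\<forall>f\<in>U. \<exists>K e. compact K \<and> K \<subseteq> G \<and> e > 0 \<and> hol_nbhd G f K e \<subseteq> U)"
proof -
  let ?P = "\<lambda>U. U \<subseteq> hol_space G \<and>
     (\<forall>f\<in>U. \<exists>K e. compact K \<and> K \<subseteq> G \<and> e > 0 \<and> hol_nbhd G f K e \<subseteq> U)"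
  have "istopology ?P"
    unfolding istopology_def
  proof (intro conjI allI impI)
    fix S T assume S: "?P S" and T: "?P T"
    show "S \<inter> T \<subseteq> hol_space G" using S by blast
    show "\<forall>f\<in>S \<inter> T. \<exists>K e. compact K \<and> K \<subseteq> G \<and> e > 0 \<and> hol_nbhd G f K e \<subseteq> S \<inter> T"
    proof
      fix f assume f: "f \<in> S \<inter> T"
      obtain K e where 1: "compact K" "K \<subseteq> G" "e > (0::real)" "hol_nbhd G f K e \<subseteq> S"
        using S f by blast
      obtain L d where 2: "compact L" "L \<subseteq> G" "d > (0::real)" "hol_nbhd G f L d \<subseteq> T"
        using T f by blast
      have "hol_nbhd G f (K \<union> L) (min e d) \<subseteq> S \<inter> T"
        using 1(4) 2(4) by (auto simp: hol_nbhd_def)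
      moreover have "compact (K \<union> L)" "K \<union> L \<subseteq> G" "min e d > 0"
        using 1 2 by (auto intro: compact_Un)
      ultimately show "\<exists>K e. compact K \<and> K \<subseteq> G \<and> e > 0 \<and> hol_nbhd G f K e \<subseteq> S \<inter> T"
        by blast
    qed
  next
    fix \<K> assume A: "\<forall>U\<in>\<K>. ?P U"
    show "\<Union>\<K> \<subseteq> hol_space G" using A by blast
    show "\<forall>f\<in>\<Union>\<K>. \<exists>K e. compact K \<and> K \<subseteq> G \<and> e > 0 \<and> hol_nbhd G f K e \<subseteq> \<Union>\<K>"
    proof
      fix f assume "f \<in> \<Union>\<K>"
      then obtain U where U: "U \<in> \<K>" "f \<in> U" by (rule UnionE)
      have "\<exists>K e. compact K \<and> K \<subseteq> G \<and> e > 0 \<and> hol_nbhd G f K e \<subseteq> U"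
        using bspec[OF A U(1)] U(2) by simp
      moreover have "U \<subseteq> \<Union>\<K>" using U(1) by (rule Union_upper)
      ultimately show "\<exists>K e. compact K \<and> K \<subseteq> G \<and> e > 0 \<and> hol_nbhd G f K e \<subseteq> \<Union>\<K>"
        by (meson subset_trans)
    qed
  qed
  then show ?thesis by (simp add: hol_topology_def)
qed

lemma topspace_hol_topology: "topspace (hol_topology G) = hol_space G"
proof
  show "topspace (hol_topology G) \<subseteq> hol_space G"
    using openin_topspace openin_hol_topology by blast
  have "openin (hol_topology G) (hol_space G)"
    unfolding openin_hol_topology
  proof (intro conjI ballI)
    fix f assume "f \<in> hol_space G"
    have "compact {} \<and> {} \<subseteq> G \<and> (1::real) > 0 \<and> hol_nbhd G f {} 1 \<subseteq> hol_space G"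
      by (simp add: hol_nbhd_def)
    then show "\<exists>K e. compact K \<and> K \<subseteq> G \<and> e > 0 \<and> hol_nbhd G f K e \<subseteq> hol_space G"
      by blast
  qed simp
  then show "hol_space G \<subseteq> topspace (hol_topology G)"
    by (rule openin_subset)
qed

lemma openin_hol_nbhd:
  assumes f: "f \<in> hol_space G" and K: "compact K" "K \<subseteq> G"
  shows "openin (hol_topology G) (hol_nbhd G f K e)"
  unfolding openin_hol_topology
proof (intro conjI ballI)
  show "hol_nbhd G f K e \<subseteq> hol_space G" by (auto simp: hol_nbhd_def)
  fix g assume g: "g \<in> hol_nbhd G f K e"
  have cont: "continuous_on K (\<lambda>z. norm (g z - f z))"
  proof -
    have "f holomorphic_on G" "g holomorphic_on G"
      using f g by (simp_all add: hol_nbhd_def hol_space_def)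
    from this[THEN holomorphic_on_imp_continuous_on]
    have "continuous_on K f" "continuous_on K g"
      using K(2) by (simp_all add: continuous_on_subset)
    then show ?thesis by (intro continuous_on_norm continuous_on_diff)
  qed
  have "\<exists>d>0. \<forall>z\<in>K. norm (g z - f z) + d \<le> e"
  proof (cases "K = {}")
    case True
    then show ?thesis using zero_less_one by blast
  next
    case False
    then obtain w where w: "w \<in> K" "\<forall>z\<in>K. norm (g z - f z) \<le> norm (g w - f w)"
      using continuous_attains_sup[OF K(1) False cont] by blast
    then have "norm (g w - f w) < e" using g by (simp add: hol_nbhd_def)
    then show ?thesis using w by (intro exI[of _ "e - norm (g w - f w)"]) auto
  qed
  then obtain d where d: "d > 0" "\<forall>z\<in>K. norm (g z - f z) + d \<le> e" by blast
  have "hol_nbhd G g K d \<subseteq> hol_nbhd G f K e"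
  proof
    fix h assume h: "h \<in> hol_nbhd G g K d"
    have "norm (h z - f z) < e" if "z \<in> K" for z
    proof -
      have "norm (h z - f z) \<le> norm (h z - g z) + norm (g z - f z)"
        using norm_triangle_ineq[of "h z - g z" "g z - f z"] by simp
      also have "\<dots> < d + norm (g z - f z)" using h that by (simp add: hol_nbhd_def)
      also have "\<dots> \<le> e" using d(2) that by (simp add: add.commute)
      finally show ?thesis .
    qed
    then show "h \<in> hol_nbhd G f K e" using h by (simp add: hol_nbhd_def)
  qed
  then show "\<exists>K' e'. compact K' \<and> K' \<subseteq> G \<and> e' > 0 \<and> hol_nbhd G g K' e' \<subseteq> hol_nbhd G f K e"
    using K d(1) by blast
qed

lemma limitin_hol_topology:
  "limitin (hol_topology G) f h F \<longleftrightarrow>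
     h \<in> hol_space G \<and> (\<forall>\<^sub>F n in F. f n \<in> hol_space G) \<and>
     (\<forall>K. compact K \<and> K \<subseteq> G \<longrightarrow> uniform_limit K f h F)"
  (is "?L \<longleftrightarrow> ?R")
proof
  assume L: ?L
  then have h: "h \<in> hol_space G" by (simp add: limitin_def topspace_hol_topology)
  have ev: "\<forall>\<^sub>F n in F. f n \<in> hol_nbhd G h K e" if "compact K" "K \<subseteq> G" "e > 0" for K e
  proof -
    have "h \<in> hol_nbhd G h K e" using h that(3) by (simp add: hol_nbhd_def)
    then show ?thesis
      using L openin_hol_nbhd[OF h that(1,2), of e] by (simp add: limitin_def)
  qed
  show ?R
  proof (intro conjI allI impI h)
    show "\<forall>\<^sub>F n in F. f n \<in> hol_space G"
      using ev[of "{}" 1] by (simp add: hol_nbhd_def)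
    fix K assume "compact K \<and> K \<subseteq> G"
    then have K: "compact K" "K \<subseteq> G" by auto
    show "uniform_limit K f h F"
      unfolding uniform_limit_iff dist_norm
    proof (intro allI impI)
      fix e :: real assume "e > 0"
      from ev[OF K this] show "\<forall>\<^sub>F n in F. \<forall>z\<in>K. norm (f n z - h z) < e"
        by (rule eventually_mono) (simp add: hol_nbhd_def)
    qed
  qed
next
  assume R: ?R
  show ?L
    unfolding limitin_def topspace_hol_topology
  proof (intro conjI allI impI)
    show "h \<in> hol_space G" using R by blast
    fix U assume U: "openin (hol_topology G) U \<and> h \<in> U"
    then obtain K e where K: "compact K" "K \<subseteq> G" "e > (0::real)" "hol_nbhd G h K e \<subseteq> U"
      unfolding openin_hol_topology by blast
    have "\<forall>\<^sub>F n in F. \<forall>z\<in>K. norm (f n z - h z) < e"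
    proof -
      have "uniform_limit K f h F" using R K(1,2) by simp
      then show ?thesis using K(3) by (simp add: uniform_limit_iff dist_norm)
    qed
    moreover have "\<forall>\<^sub>F n in F. f n \<in> hol_space G" using R by blast
    ultimately have "\<forall>\<^sub>F n in F. f n \<in> hol_nbhd G h K e"
      by eventually_elim (simp add: hol_nbhd_def)
    then show "\<forall>\<^sub>F n in F. f n \<in> U"
      by (rule eventually_mono) (use K(4) in blast)
  qed
qed

definition fun_scale :: "complex \<Rightarrow> (complex \<Rightarrow> complex) \<Rightarrow> complex \<Rightarrow> complex" where
  "fun_scale c f = (\<lambda>z. c * f z)"

definition pair_scale :: "complex \<Rightarrow> (complex \<Rightarrow> complex) \<times> (complex \<Rightarrow> complex) \<Rightarrow>
    (complex \<Rightarrow> complex) \<times> (complex \<Rightarrow> complex)" where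
  "pair_scale c p = (fun_scale c (fst p), fun_scale c (snd p))"

text \<open>
  The spaces are given by topologies \<open>X\<close>, \<open>Y\<close> whose carriers \<open>topspace X\<close>, \<open>topspace Y\<close> are
  complex linear subspaces of the ambient types, with scalar multiplications \<open>sX\<close>, \<open>sY\<close>;
  an operator is only constrained on \<open>topspace X\<close>.
\<close>

definition continuous_linear_operator ::
    "(complex \<Rightarrow> 'a \<Rightarrow> 'a::ab_group_add) \<Rightarrow> (complex \<Rightarrow> 'b \<Rightarrow> 'b::ab_group_add) \<Rightarrow>
     'a topology \<Rightarrow> 'b topology \<Rightarrow> ('a \<Rightarrow> 'b) \<Rightarrow> bool" where
  "continuous_linear_operator sX sY X Y T \<longleftrightarrow>
     continuous_map X Y T \<and>
     (\<forall>x\<in>topspace X. \<forall>y\<in>topspace X. T (x + y) = T x + T y) \<and>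
     (\<forall>c. \<forall>x\<in>topspace X. T (sX c x) = sY c (T x))"

text \<open>Operator sequences are indexed by \<open>n = 1, 2, \<dots>\<close>; the value at \<open>0\<close> is irrelevant.\<close>

definition universal_sequence ::
    "(complex \<Rightarrow> 'a \<Rightarrow> 'a::ab_group_add) \<Rightarrow> (complex \<Rightarrow> 'b \<Rightarrow> 'b::ab_group_add) \<Rightarrow>
     'a topology \<Rightarrow> 'b topology \<Rightarrow> (nat \<Rightarrow> 'a \<Rightarrow> 'b) \<Rightarrow> bool" where
  "universal_sequence sX sY X Y T \<longleftrightarrow>
     (\<forall>n\<ge>1. continuous_linear_operator sX sY X Y (T n)) \<and>
     (\<exists>x0\<in>topspace X. Y closure_of {T n x0 | n. n \<ge> 1} = topspace Y)"

definition taylor_op :: "complex set \<Rightarrow> nat \<Rightarrow> (complex \<Rightarrow> complex) \<Rightarrow> complex \<Rightarrow> complex" where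
  "taylor_op G n f = (\<lambda>\<zeta>. if \<zeta> \<in> G
     then (\<Sum>j=0..n. (deriv ^^ j) f \<zeta> / fact j * (- \<zeta>) ^ j) else 0)"

end

theory Submission
  imports Defs
begin

text \<open>
  Write \<open>T n\<close> for \<open>taylor_op G n\<close>. Two kinds of functions behave transparently under these operators.
  A polynomial of degree at most \<open>n\<close> is sent by \<open>T n\<close> to its value at \<open>0\<close>
  (\<open>taylor_op_poly\<close>), and the negative powers \<open>inverse z ^ m\<close>, \<open>m \<ge> 1\<close>, are eigenvectors whose
  eigenvalues grow like \<open>n ^ m\<close> (\<open>taylor_op_inverse_power\<close>). Since \<open>G\<close> is simply connected and omits
  \<open>0\<close>, Runge's theorem (\<open>runge_simply_connected\<close>) shows that the polynomials vanishing at \<open>0\<close> and the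
  polynomials in \<open>inverse z\<close> without constant term are both dense in the space of holomorphic functions.

  By a category argument (\<open>hol_topology_Baire\<close>) it suffices that every nonempty open set of functions contains
  some \<open>h\<close> that \<open>T (l1 n)\<close> and \<open>T (l2 n)\<close> send close to two prescribed targets, for some \<open>n \<ge> 1\<close>
  (\<open>simultaneous_approximation\<close>). Take \<open>h\<close> as a polynomial vanishing at \<open>0\<close>, which both operators
  annihilate for large \<open>n\<close>, plus a perturbation tending to \<open>0\<close> that produces the targets. By linearity
  and density the targets may be assumed to be \<open>(0, inverse z ^ m)\<close> or \<open>(inverse z ^ m, 0)\<close>.

  In the first case the perturbation is \<open>inverse z ^ m\<close> divided by its eigenvalue of order \<open>l2 n\<close>;
  \<open>T (l1 n)\<close> makes it small because \<open>l1 n / l2 n\<close> tends to \<open>0\<close> (\<open>steerable_second\<close>). In the second case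
  division by the eigenvalue of order \<open>l1 n\<close> is spoilt by \<open>T (l2 n)\<close>, and here lies the idea of the proof: replace
  \<open>inverse z ^ m\<close> by a polynomial of degree at most \<open>l2 n\<close> vanishing at \<open>0\<close>, which \<open>T (l2 n)\<close>
  annihilates (\<open>steerable_first\<close>). The replacement must survive \<open>T (l1 n)\<close>, which amplifies errors by a
  factor \<open>A ^ l1 n\<close> with \<open>A\<close> depending only on the compact set (\<open>taylor_op_compact_bound\<close>). Polynomials of
  degree \<open>k\<close> approximate \<open>inverse z ^ m\<close> with an error that is geometrically small in \<open>k\<close>
  (\<open>geometric_poly_approx_inverse_power\<close>), so a degree equal to a large multiple of \<open>l1 n\<close> is enough,
  and \<open>l2 n / l1 n \<rightarrow> \<infinity>\<close> leaves room for it.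
\<close>

section \<open>Uniform limits of polynomials on compact sets\<close>

definition poly_approx :: "complex set \<Rightarrow> (complex \<Rightarrow> complex) \<Rightarrow> bool" where
  "poly_approx K f \<longleftrightarrow> (\<forall>e>0. \<exists>p. \<forall>z\<in>K. norm (f z - poly p z) < e)"

lemma poly_approx_poly: "poly_approx K (poly p)"
  unfolding poly_approx_def by (metis diff_self norm_zero)

lemma poly_approx_const: "poly_approx K (\<lambda>z. c)"
  unfolding poly_approx_def by (intro allI impI exI[of _ "[:c:]"]) simp

lemma poly_approx_ident: "poly_approx K (\<lambda>z. z)"
  unfolding poly_approx_def by (intro allI impI exI[of _ "[:0, 1:]"]) simp

lemma poly_approx_cong: "(\<And>z. z \<in> K \<Longrightarrow> f z = g z) \<Longrightarrow> poly_approx K f \<longleftrightarrow> poly_approx K g"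
  unfolding poly_approx_def by simp

lemma poly_approx_subset: "poly_approx L f \<Longrightarrow> K \<subseteq> L \<Longrightarrow> poly_approx K f"
  unfolding poly_approx_def by (meson subsetD)

lemma poly_approx_limit:
  assumes "\<And>e. e > 0 \<Longrightarrow> \<exists>g. poly_approx K g \<and> (\<forall>z\<in>K. norm (f z - g z) < e)"
  shows "poly_approx K f"
  unfolding poly_approx_def
proof (intro allI impI)
  fix e :: real assume "e > 0"
  then obtain g where g: "poly_approx K g" "\<forall>z\<in>K. norm (f z - g z) < e / 2"
    using assms[of "e / 2"] by auto
  then obtain p where p: "\<forall>z\<in>K. norm (g z - poly p z) < e / 2"
    using \<open>e > 0\<close> unfolding poly_approx_def by (meson half_gt_zero)
  show "\<exists>p. \<forall>z\<in>K. norm (f z - poly p z) < e"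
    using g(2) p norm_diff_triangle_less[of _ _ "e / 2" _ "e / 2"]
    by (intro exI[of _ p]) fastforce
qed

lemma poly_approx_bounded:
  assumes "compact K" "poly_approx K f"
  obtains B where "B > 0" "\<And>z. z \<in> K \<Longrightarrow> norm (f z) \<le> B"
proof -
  obtain p where p: "\<forall>z\<in>K. norm (f z - poly p z) < 1"
    using assms(2) unfolding poly_approx_def by (meson zero_less_one)
  have "compact (poly p ` K)"
    by (intro compact_continuous_image assms continuous_intros)
  then obtain C where C: "C > 0" "\<forall>z\<in>K. norm (poly p z) \<le> C"
    using compact_imp_bounded[of "poly p ` K"] unfolding bounded_pos by auto
  have "norm (f z) \<le> C + 1" if "z \<in> K" for z
    using norm_triangle_ineq[of "f z - poly p z" "poly p z"] p C(2) that by fastforce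
  then show thesis using C(1) that[of "C + 1"] by simp
qed

lemma poly_approx_add:
  assumes "poly_approx K f" "poly_approx K g"
  shows "poly_approx K (\<lambda>z. f z + g z)"
  unfolding poly_approx_def
proof (intro allI impI)
  fix e :: real assume "e > 0"
  then have "e / 2 > 0" by simp
  then obtain p q where "\<forall>z\<in>K. norm (f z - poly p z) < e / 2" "\<forall>z\<in>K. norm (g z - poly q z) < e / 2"
    using assms unfolding poly_approx_def by meson
  then show "\<exists>p. \<forall>z\<in>K. norm (f z + g z - poly p z) < e"
    by (intro exI[of _ "p + q"]) (fastforce intro!: norm_diff_triangle_ineq[THEN le_less_trans])
qed

lemma poly_approx_mult:
  assumes "compact K" "poly_approx K f" "poly_approx K g"
  shows "poly_approx K (\<lambda>z. f z * g z)"
proof (rule poly_approx_limit)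
  fix e :: real assume "e > 0"
  obtain B where B: "B > 0" "\<And>z. z \<in> K \<Longrightarrow> norm (f z) \<le> B"
    using poly_approx_bounded[OF assms(1,2)] by blast
  obtain q where q: "\<forall>z\<in>K. norm (g z - poly q z) < e / B"
    using assms(3) \<open>e > 0\<close> B(1) unfolding poly_approx_def by (meson divide_pos_pos)
  obtain C where C: "C > 0" "\<And>z. z \<in> K \<Longrightarrow> norm (poly q z) \<le> C"
    using poly_approx_bounded[OF assms(1) poly_approx_poly] by blast
  show "\<exists>h. poly_approx K h \<and> (\<forall>z\<in>K. norm (f z * g z - h z) < e)"
  proof (intro exI[of _ "\<lambda>z. f z * poly q z"] conjI ballI)
    show "poly_approx K (\<lambda>z. f z * poly q z)"
      unfolding poly_approx_def
    proof (intro allI impI)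
      fix d :: real assume "d > 0"
      obtain p where p: "\<forall>z\<in>K. norm (f z - poly p z) < d / C"
        using assms(2) \<open>d > 0\<close> C(1) unfolding poly_approx_def by (meson divide_pos_pos)
      have "norm (f z * poly q z - poly (p * q) z) < d" if "z \<in> K" for z
      proof -
        have "norm (f z * poly q z - poly (p * q) z) = norm (f z - poly p z) * norm (poly q z)"
          by (simp add: algebra_simps flip: norm_mult)
        also have "\<dots> \<le> norm (f z - poly p z) * C"
          by (intro mult_left_mono C that) simp
        also have "\<dots> < d" using p that C(1) by (simp add: field_simps)
        finally show ?thesis .
      qed
      then show "\<exists>p. \<forall>z\<in>K. norm (f z * poly q z - poly p z) < d" by blast
    qed
  next
    fix z assume z: "z \<in> K"
    have "norm (f z * g z - f z * poly q z) = norm (f z) * norm (g z - poly q z)"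
      by (simp add: algebra_simps flip: norm_mult)
    also have "\<dots> \<le> B * norm (g z - poly q z)" by (intro mult_right_mono B z) simp
    also have "\<dots> < e" using q z B(1) by (simp add: field_simps)
    finally show "norm (f z * g z - f z * poly q z) < e" .
  qed
qed

lemma poly_approx_power:
  assumes "compact K" "poly_approx K f"
  shows "poly_approx K (\<lambda>z. f z ^ n)"
  by (induction n) (auto intro: poly_approx_const poly_approx_mult assms)

lemma poly_approx_sum:
  assumes "\<And>i. i \<in> I \<Longrightarrow> poly_approx K (f i)"
  shows "poly_approx K (\<lambda>z. \<Sum>i\<in>I. f i z)"
  using assms
  by (induction I rule: infinite_finite_induct) (auto intro: poly_approx_const poly_approx_add)

text \<open>
  Expand \<open>1 / (1 - g)\<close> as a geometric series. Both ways of moving a pole, from infinity to a distant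
  point and from a point to a nearby one, are instances of this.
\<close>

lemma poly_approx_geometric:
  assumes K: "compact K" and f: "poly_approx K f" and g: "poly_approx K g"
    and g_le: "\<And>z. z \<in> K \<Longrightarrow> norm (g z) \<le> 1 / 2"
  shows "poly_approx K (\<lambda>z. f z / (1 - g z))"
proof (rule poly_approx_limit)
  fix e :: real assume "e > 0"
  obtain B where B: "B > 0" "\<And>z. z \<in> K \<Longrightarrow> norm (f z) \<le> B"
    using poly_approx_bounded[OF K f] by blast
  obtain n where n: "(1 / 2) ^ n < e / (2 * B)"
    using real_arch_pow_inv[of "e / (2 * B)" "1 / 2"] \<open>e > 0\<close> B(1) by auto
  show "\<exists>h. poly_approx K h \<and> (\<forall>z\<in>K. norm (f z / (1 - g z) - h z) < e)"
  proof (intro exI[of _ "\<lambda>z. \<Sum>k<n. f z * g z ^ k"] conjI ballI)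
    show "poly_approx K (\<lambda>z. \<Sum>k<n. f z * g z ^ k)"
      by (intro poly_approx_sum poly_approx_mult poly_approx_power K f g)
  next
    fix z assume z: "z \<in> K"
    have ne: "1 - g z \<noteq> 0" using g_le[OF z] by auto
    have "1 / 2 \<le> norm (1 - g z)"
      using norm_triangle_ineq2[of 1 "g z"] g_le[OF z] by simp
    then have inv: "1 / norm (1 - g z) \<le> 2" using ne by (simp add: field_simps)
    have "(\<Sum>k<n. f z * g z ^ k) = f z * ((1 - g z ^ n) / (1 - g z))"
      using ne by (simp add: sum_gp_strict flip: sum_distrib_left)
    then have "f z / (1 - g z) - (\<Sum>k<n. f z * g z ^ k) = f z * g z ^ n * (1 / (1 - g z))"
      using ne by (simp add: field_simps)
    then have "norm (f z / (1 - g z) - (\<Sum>k<n. f z * g z ^ k))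
        = norm (f z) * norm (g z) ^ n * (1 / norm (1 - g z))"
      by (simp add: norm_mult norm_power norm_divide)
    also have "\<dots> \<le> B * (1 / 2) ^ n * 2"
      by (intro mult_mono power_mono g_le B z inv) (use B(1) in auto)
    also have "\<dots> < e" using n B(1) by (simp add: field_simps)
    finally show "norm (f z / (1 - g z) - (\<Sum>k<n. f z * g z ^ k)) < e" .
  qed
qed

section \<open>Runge's theorem for simply connected domains\<close>

text \<open>
  Pole pushing. A pole of large modulus can be handled by the geometric series, and whether a pole
  can be handled is locally constant on \<open>- L\<close>: if \<open>x\<close> and \<open>y\<close> are much closer to each
  other than to \<open>L\<close>, then \<open>1 / (y - z) = (1 / (x - z)) / (1 - (x - y) / (x - z))\<close> is a geometric series
  in the kernel with pole \<open>x\<close>. Connectedness of \<open>- L\<close> does the rest.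
\<close>

lemma poly_approx_cauchy_kernel:
  assumes L: "compact L" "connected (- L)" and w: "w \<notin> L"
  shows "poly_approx L (\<lambda>z. 1 / (w - z))"
proof -
  obtain R where R: "R > 0" "\<And>z. z \<in> L \<Longrightarrow> norm z \<le> R"
    using compact_imp_bounded[OF L(1)] unfolding bounded_pos by blast
  define w0 where "w0 = complex_of_real (2 * R)"
  have w0: "norm w0 = 2 * R" using R(1) by (simp add: w0_def)
  have "w0 \<notin> L" using R w0 by force
  have "poly_approx L (\<lambda>z. (1 / w0) / (1 - 1 / w0 * z))"
  proof (intro poly_approx_geometric L poly_approx_const poly_approx_mult poly_approx_ident)
    show "norm (1 / w0 * z) \<le> 1 / 2" if "z \<in> L" for z
      using R that w0 by (simp add: norm_divide field_simps)
  qed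
  moreover have "(1 / w0) / (1 - 1 / w0 * z) = 1 / (w0 - z)" for z
    using w0 R(1) by (auto simp: divide_simps)
  ultimately have base: "poly_approx L (\<lambda>z. 1 / (w0 - z))" by simp
  show ?thesis
  proof (rule connected_induction_simple[OF L(2), where a = w0 and
        P = "\<lambda>w. poly_approx L (\<lambda>z. 1 / (w - z))"])
    fix a assume a: "a \<in> - L"
    have "open (- L)" using L(1) by (simp add: compact_imp_closed open_Compl)
    then obtain d where d: "d > 0" "ball a d \<subseteq> - L" using a openE by blast
    show "\<exists>T. openin (top_of_set (- L)) T \<and> a \<in> T \<and>
      (\<forall>x\<in>T. \<forall>y\<in>T. poly_approx L (\<lambda>z. 1 / (x - z)) \<longrightarrow> poly_approx L (\<lambda>z. 1 / (y - z)))"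
    proof (intro exI[of _ "ball a (d / 8)"] conjI ballI impI)
      show "openin (top_of_set (- L)) (ball a (d / 8))"
        using d(2) subset_ball[of "d / 8" d a] d(1) by (intro open_subset) auto
      show "a \<in> ball a (d / 8)" using d by simp
    next
      fix x y assume x: "x \<in> ball a (d / 8)" and y: "y \<in> ball a (d / 8)"
        and A: "poly_approx L (\<lambda>z. 1 / (x - z))"
      have far: "2 * norm (x - y) \<le> norm (x - z)" "x \<noteq> z" "y \<noteq> z" if "z \<in> L" for z
      proof -
        have "d \<le> dist a z" using d that by (meson ComplD mem_ball not_le subsetD)
        moreover have "dist a z \<le> dist a x + dist x z" by (rule dist_triangle)
        moreover have "dist x y \<le> dist a x + dist a y" by (rule dist_triangle3)
        ultimately show "2 * norm (x - y) \<le> norm (x - z)" "x \<noteq> z" "y \<noteq> z"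
          using x y d(1) by (auto simp flip: dist_norm)
      qed
      have "poly_approx L (\<lambda>z. (1 / (x - z)) / (1 - (x - y) * (1 / (x - z))))"
      proof (intro poly_approx_geometric L poly_approx_const poly_approx_mult A)
        show "norm ((x - y) * (1 / (x - z))) \<le> 1 / 2" if "z \<in> L" for z
          using far[OF that] by (simp add: norm_mult norm_divide field_simps)
      qed
      then show "poly_approx L (\<lambda>z. 1 / (y - z))"
        by (rule poly_approx_cong[THEN iffD1, rotated]) (use far in \<open>auto simp: divide_simps\<close>)
    qed
  qed (use w \<open>w0 \<notin> L\<close> base in auto)
qed

text \<open>
  The estimate is by induction on the number of subintervals already covered. What matters for its
  use is that the error bound refers to the oscillation of \<open>h\<close> only, so it is uniform over a family of
  integrands with a common modulus of continuity.
\<close>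

lemma riemann_sum_error:
  fixes h :: "real \<Rightarrow> complex"
  assumes h: "continuous_on {0..1} h" and N: "N > 0"
    and osc: "\<And>j t. j < N \<Longrightarrow> t \<in> {real j / N..real (Suc j) / N} \<Longrightarrow> norm (h t - h (real j / N)) \<le> e"
  shows "norm (integral {0..1} h - (\<Sum>j<N. h (real j / N) / N)) \<le> e"
proof -
  have "k \<le> N \<Longrightarrow>
    norm (integral {0..real k / N} h - (\<Sum>j<k. h (real j / N) / N)) \<le> e * (real k / N)" for k
  proof (induction k)
    case (Suc k)
    let ?a = "real k / N" and ?b = "real (Suc k) / N"
    have ab: "0 \<le> ?a" "?a \<le> ?b" "?b \<le> 1" using Suc.prems N by (simp_all add: field_simps)
    have int: "h integrable_on {0..?b}" "h integrable_on {?a..?b}"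
      by (intro integrable_continuous_real continuous_on_subset[OF h];
          use ab in \<open>auto simp del: of_nat_Suc\<close>)+
    have "((\<lambda>t. h t - h ?a) has_integral integral {?a..?b} h - (?b - ?a) *\<^sub>R h ?a) {?a..?b}"
      using has_integral_diff[OF integrable_integral[OF int(2)] has_integral_const_real[of "h ?a" ?a ?b]] ab
      by simp
    moreover have "0 \<le> e" using osc[of k ?a] Suc.prems ab by simp
    ultimately have "norm (integral {?a..?b} h - (?b - ?a) *\<^sub>R h ?a) \<le> e * measure lborel {?a..?b}"
      using osc[of k] Suc.prems by (intro has_integral_bound_real[where S = "{}"]) auto
    then have "norm (integral {?a..?b} h - (?b - ?a) *\<^sub>R h ?a) \<le> e * (?b - ?a)"
      using ab by simp
    moreover have ba: "?b - ?a = 1 / N" using N by (simp add: field_simps)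
    ultimately have "norm (integral {?a..?b} h - h ?a / N) \<le> e * (1 / N)"
      unfolding ba by (simp add: scaleR_conv_of_real)
    moreover have "integral {0..?b} h = integral {0..?a} h + integral {?a..?b} h"
      using Henstock_Kurzweil_Integration.integral_combine[OF ab(1,2) int(1)] by simp
    ultimately have "norm (integral {0..?b} h - (\<Sum>j<Suc k. h (real j / N) / N))
        \<le> e * (real k / N) + e * (1 / N)"
      using Suc norm_triangle_ineq[of "integral {0..?a} h - (\<Sum>j<k. h (real j / N) / N)"
          "integral {?a..?b} h - h ?a / N"]
      by (simp add: algebra_simps)
    moreover have "e * (real k / N) + e * (1 / N) = e * (real (Suc k) / N)"
      by (simp add: add_divide_distrib algebra_simps)
    ultimately show ?case by simp
  qed simp
  from this[of N] show ?thesis using N by simp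
qed

text \<open>
  Joint uniform continuity makes Riemann sums converge uniformly in the parameter \<open>z\<close>, and a Riemann sum
  is a finite linear combination of approximable functions.
\<close>

lemma poly_approx_integral:
  assumes L: "compact L" and H: "continuous_on ({0..1} \<times> L) (\<lambda>(t, z). H t z)"
    and approx: "\<And>t. t \<in> {0..1} \<Longrightarrow> poly_approx L (H t)"
  shows "poly_approx L (\<lambda>z. integral {0..1::real} (\<lambda>t. H t z))"
proof (rule poly_approx_limit)
  fix e :: real assume "e > 0"
  have "uniformly_continuous_on ({0..1} \<times> L) (\<lambda>(t, z). H t z)"
    by (intro compact_uniformly_continuous H compact_Times L) simp
  then obtain d where d: "d > 0" "\<And>t z t' z'. t \<in> {0..1} \<Longrightarrow> z \<in> L \<Longrightarrow> t' \<in> {0..1} \<Longrightarrow> z' \<in> L \<Longrightarrow>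
      dist (t', z') (t, z) < d \<Longrightarrow> dist (H t' z') (H t z) < e / 2"
    unfolding uniformly_continuous_on_def using \<open>e > 0\<close>
    by (metis (no_types, lifting) SigmaI case_prod_conv half_gt_zero)
  obtain N :: nat where N: "N > 0" "1 / real N < d"
    using d(1) by (metis nat_approx_posE zero_less_Suc of_nat_Suc)
  show "\<exists>g. poly_approx L g \<and> (\<forall>z\<in>L. norm (integral {0..1} (\<lambda>t. H t z) - g z) < e)"
  proof (intro exI[of _ "\<lambda>z. \<Sum>j<N. (1 / of_nat N) * H (real j / N) z"] conjI ballI)
    show "poly_approx L (\<lambda>z. \<Sum>j<N. (1 / of_nat N) * H (real j / N) z)"
      by (intro poly_approx_sum poly_approx_mult poly_approx_const L approx) auto
  next
    fix z assume z: "z \<in> L"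
    have "norm (integral {0..1} (\<lambda>t. H t z) - (\<Sum>j<N. H (real j / N) z / N)) \<le> e / 2"
    proof (rule riemann_sum_error)
      show "continuous_on {0..1} (\<lambda>t. H t z)"
        using continuous_on_compose2[OF H, of "{0..1}" "\<lambda>t. (t, z)"] z
        by (auto simp: continuous_on_Pair continuous_on_id)
    next
      fix j t assume j: "j < N" and t: "t \<in> {real j / N..real (Suc j) / N}"
      have 1: "real j / N \<in> {0..1}" "0 \<le> real j / N" "real (Suc j) / N \<le> 1"
        using j by (auto simp: field_simps)
      have 2: "t \<in> {0..1}" using 1 t by (meson atLeastAtMost_iff order_trans)
      have "real (Suc j) / N = real j / N + 1 / N" by (simp add: add_divide_distrib)
      then have "dist t (real j / N) \<le> 1 / N" using t by (simp add: dist_real_def abs_le_iff)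
      then have "dist (t, z) (real j / N, z) < d" using N(2) by (simp add: dist_Pair_Pair)
      then show "norm (H t z - H (real j / N) z) \<le> e / 2"
        using d(2)[OF 1(1) z 2 z] by (simp add: dist_norm)
    qed (use N in simp)
    then show "norm (integral {0..1} (\<lambda>t. H t z) - (\<Sum>j<N. (1 / of_nat N) * H (real j / N) z)) < e"
      using \<open>e > 0\<close> by simp
  qed
qed

text \<open>
  Cauchy's formula for a loop that runs around the image of a disc, obtained without winding numbers:
  after the substitution by \<open>\<psi>\<close> the integrand differs from \<open>h u / (u - v)\<close> only by the removable
  singularity of the difference quotient \<open>q\<close> of \<open>\<psi>\<close>, which has no zeros as \<open>\<psi>\<close> is injective.
\<close>

lemma cauchy_formula_biholomorphic:
  assumes f: "f holomorphic_on G" and \<psi>: "\<psi> holomorphic_on ball 0 1" "\<psi> ` ball 0 1 \<subseteq> G"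
    and inj: "inj_on \<psi> (ball 0 1)" and r: "r < 1" and v: "norm v < r"
  shows "contour_integral (circlepath 0 r) (\<lambda>u. f (\<psi> u) * deriv \<psi> u / (\<psi> u - \<psi> v))
    = 2 * of_real pi * \<i> * f (\<psi> v)"
proof -
  have v1: "v \<in> ball 0 1" using r v by simp
  define q where "q = (\<lambda>u. if u = v then deriv \<psi> v else (\<psi> u - \<psi> v) / (u - v))"
  have q: "q holomorphic_on ball 0 1"
    unfolding q_def by (rule pole_lemma_open[OF \<psi>(1) open_ball])
  have q_nz: "q u \<noteq> 0" if "u \<in> ball 0 1" for u
    using holomorphic_injective_imp_regular[OF \<psi>(1) open_ball inj v1] that inj v1
    by (auto simp: q_def inj_on_def)
  define h where "h = (\<lambda>u. f (\<psi> u) * deriv \<psi> u / q u)"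
  have "f \<circ> \<psi> holomorphic_on ball 0 1"
    by (rule holomorphic_on_compose_gen[OF \<psi>(1) f \<psi>(2)])
  then have h: "h holomorphic_on ball 0 1"
    unfolding h_def o_def by (intro holomorphic_intros q \<psi>(1) q_nz open_ball)
  have sub: "cball 0 r \<subseteq> ball (0::complex) 1" using r by auto
  have "((\<lambda>u. h u / (u - v)) has_contour_integral (2 * of_real pi * \<i> * h v)) (circlepath 0 r)"
    by (rule Cauchy_integral_circlepath_simple)
       (use holomorphic_on_subset[OF h sub] v in \<open>auto\<close>)
  then have "((\<lambda>u. f (\<psi> u) * deriv \<psi> u / (\<psi> u - \<psi> v)) has_contour_integral (2 * of_real pi * \<i> * h v)) (circlepath 0 r)"
  proof (rule has_contour_integral_eq)
    fix u assume u: "u \<in> path_image (circlepath 0 r)"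
    have "0 < r" using v norm_ge_zero[of v] by linarith
    then have "u \<noteq> v" "u \<in> ball 0 1" using u v r by auto
    then show "h u / (u - v) = f (\<psi> u) * deriv \<psi> u / (\<psi> u - \<psi> v)"
      by (simp add: h_def q_def)
  qed
  moreover have "h v = f (\<psi> v)"
    using q_nz[OF v1] by (simp add: h_def q_def)
  ultimately show ?thesis using contour_integral_unique by metis
qed

text \<open>
  The Riemann map \<open>\<psi>\<close> presents \<open>K\<close> inside \<open>L = \<psi> ` cball 0 s\<close> with \<open>s < 1\<close>. Cauchy's formula along the
  \<open>\<psi>\<close>-image of a slightly larger circle writes \<open>f\<close> as an integral of Cauchy kernels with poles off \<open>L\<close>.
  Since \<open>L\<close> is homeomorphic to a disc, its complement is connected, so each of these kernels is a
  uniform limit of polynomials on \<open>L\<close>, and then so is the integral.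
\<close>

theorem runge_simply_connected:
  assumes G: "open G" "simply_connected G" "G \<noteq> UNIV" and K: "compact K" "K \<subseteq> G"
    and f: "f holomorphic_on G"
  shows "poly_approx K f"
proof (cases "K = {}")
  case True
  then show ?thesis by (simp add: poly_approx_def)
next
  case False
  then have "G \<noteq> {}" using K by auto
  then obtain \<phi> \<psi> where \<phi>: "\<phi> holomorphic_on G" and \<psi>: "\<psi> holomorphic_on ball 0 1"
    and \<phi>\<psi>: "\<And>z. z \<in> G \<Longrightarrow> \<phi> z \<in> ball 0 1 \<and> \<psi> (\<phi> z) = z"
    and \<psi>\<phi>: "\<And>u. u \<in> ball 0 1 \<Longrightarrow> \<psi> u \<in> G \<and> \<phi> (\<psi> u) = u"
    using Riemann_mapping_theorem[of G] G by blast
  have \<psi>_sub: "\<psi> ` ball 0 1 \<subseteq> G" using \<psi>\<phi> by blast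
  have inj: "inj_on \<psi> (ball 0 1)" by (rule inj_on_inverseI[of _ \<phi>]) (use \<psi>\<phi> in blast)
  have cont\<psi>: "continuous_on (ball 0 1) \<psi>" by (rule holomorphic_on_imp_continuous_on[OF \<psi>])
  have "continuous_on K (\<lambda>z. norm (\<phi> z))"
    using holomorphic_on_imp_continuous_on[OF \<phi>] K(2)
    by (intro continuous_on_norm) (rule continuous_on_subset)
  then obtain z0 where z0: "z0 \<in> K" "\<And>z. z \<in> K \<Longrightarrow> norm (\<phi> z) \<le> norm (\<phi> z0)"
    using continuous_attains_sup[OF K(1) False] by blast
  define s where "s = norm (\<phi> z0)"
  have s: "0 \<le> s" "s < 1" using \<phi>\<psi>[of z0] z0 K by (auto simp: s_def)
  define r where "r = (s + 1) / 2"
  have r: "s < r" "r < 1" "0 < r" using s by (auto simp: r_def)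
  define L where "L = \<psi> ` cball 0 s"
  have s_ball: "cball 0 s \<subseteq> ball (0::complex) 1" using s by auto
  have cont\<psi>s: "continuous_on (cball 0 s) \<psi>" using cont\<psi> s_ball by (rule continuous_on_subset)
  have L: "compact L" unfolding L_def by (intro compact_continuous_image cont\<psi>s) simp
  have "K \<subseteq> L"
  proof
    fix z assume "z \<in> K"
    then have "z = \<psi> (\<phi> z)" "\<phi> z \<in> cball 0 s" using \<phi>\<psi> K z0 by (auto simp: s_def)
    then show "z \<in> L" unfolding L_def by blast
  qed
  have "L homeomorphic cball (0::complex) s"
    unfolding L_def using homeomorphic_compact[OF compact_cball cont\<psi>s refl] inj s_ball
    by (meson homeomorphic_sym inj_on_subset)
  then have conn: "connected (- L)"
    by (rule connected_complement_homeomorphic_convex_compact) auto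
  define c where "c = (\<lambda>t::real. circlepath 0 r t)"
  have c_norm: "norm (c t) = r" for t using r by (simp add: c_def circlepath norm_mult)
  then have c_ball: "c t \<in> ball 0 1" for t using r by simp
  have c_cont: "continuous_on A c" for A
    unfolding c_def circlepath by (intro continuous_intros)
  have \<psi>c: "\<psi> (c t) \<notin> L" for t
  proof
    assume "\<psi> (c t) \<in> L"
    then obtain v where "v \<in> cball 0 s" "\<psi> (c t) = \<psi> v" by (auto simp: L_def)
    then have "c t = v" using inj c_ball s_ball by (meson inj_onD subsetD)
    then show False using \<open>v \<in> cball 0 s\<close> c_norm[of t] r by simp
  qed
  define F where "F = (\<lambda>t. f (\<psi> (c t)) * deriv \<psi> (c t) * (r * exp (2 * of_real pi * \<i> * t)))"
  define H where "H = (\<lambda>(t::real) z. F t * (1 / (\<psi> (c t) - z)))"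
  have cont\<psi>c: "continuous_on A (\<lambda>t. \<psi> (c t))" for A
    by (rule continuous_on_compose2[OF cont\<psi> c_cont]) (use c_ball in auto)
  have "continuous_on A F" for A
    unfolding F_def
    by (intro continuous_intros continuous_on_compose2[OF holomorphic_on_imp_continuous_on[OF f] cont\<psi>c]
        continuous_on_compose2[OF holomorphic_on_imp_continuous_on[OF holomorphic_deriv[OF \<psi> open_ball]] c_cont])
       (use c_ball \<psi>\<phi> in auto)
  then have "continuous_on ({0..1} \<times> L) (\<lambda>(t, z). H t z)"
    unfolding H_def case_prod_unfold using \<psi>c
    by (intro continuous_intros continuous_on_compose2[OF _ continuous_on_fst, of _ F]
        continuous_on_compose2[OF cont\<psi>c continuous_on_fst]) auto
  moreover have "poly_approx L (H t)" for t
    unfolding H_def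
    by (intro poly_approx_mult poly_approx_const poly_approx_cauchy_kernel L conn \<psi>c)
  ultimately have "poly_approx L (\<lambda>z. integral {0..1} (\<lambda>t. H t z))"
    by (intro poly_approx_integral L)
  moreover have "integral {0..1} (\<lambda>t. H t z) = f z" if z: "z \<in> L" for z
  proof -
    obtain v where v: "norm v < r" "z = \<psi> v" using z r by (force simp: L_def)
    have "2 * of_real pi * \<i> * f z
        = integral {0..1} (\<lambda>t. f (\<psi> (c t)) * deriv \<psi> (c t) / (\<psi> (c t) - z) *
            (2 * of_real pi * \<i> * r * exp (2 * of_real pi * \<i> * t)))"
      using cauchy_formula_biholomorphic[OF f \<psi> \<psi>_sub inj r(2) v(1)] v(2)
      by (simp add: contour_integral_integral vector_derivative_circlepath c_def)
    also have "\<dots> = integral {0..1} (\<lambda>t. 2 * of_real pi * \<i> * H t z)"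
      by (intro integral_cong) (simp add: H_def F_def)
    also have "\<dots> = 2 * of_real pi * \<i> * integral {0..1} (\<lambda>t. H t z)" by (rule integral_mult_right)
    finally show ?thesis by simp
  qed
  ultimately have "poly_approx L f" using poly_approx_cong by (metis (no_types, lifting))
  then show ?thesis using \<open>K \<subseteq> L\<close> by (rule poly_approx_subset)
qed

section \<open>The Taylor operators on holomorphic functions\<close>

text \<open>
  The representative in \<open>hol_space G\<close> of a function that is holomorphic on \<open>G\<close>.
\<close>

definition cut :: "complex set \<Rightarrow> (complex \<Rightarrow> complex) \<Rightarrow> complex \<Rightarrow> complex" where
  "cut G f = (\<lambda>z. if z \<in> G then f z else 0)"

lemma cut_in_hol_space: "f holomorphic_on G \<Longrightarrow> cut G f \<in> hol_space G"
  unfolding hol_space_def cut_def by (auto elim!: holomorphic_transform)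

lemma taylor_op_cong:
  assumes "open G" "f holomorphic_on G" "\<And>z. z \<in> G \<Longrightarrow> g z = f z"
  shows "taylor_op G n g = taylor_op G n f"
proof -
  have "g holomorphic_on G"
    using assms(2,3) by (metis holomorphic_cong)
  then show ?thesis
    unfolding taylor_op_def using higher_deriv_transform_within_open[of g G f] assms
    by (intro ext) auto
qed

lemma taylor_op_cut: "open G \<Longrightarrow> f holomorphic_on G \<Longrightarrow> taylor_op G n (cut G f) = taylor_op G n f"
  by (rule taylor_op_cong) (auto simp: cut_def)

lemma taylor_op_add:
  assumes "open G" "f holomorphic_on G" "g holomorphic_on G"
  shows "taylor_op G n (\<lambda>z. f z + g z) = (\<lambda>z. taylor_op G n f z + taylor_op G n g z)"
  unfolding taylor_op_def
  using higher_deriv_add[OF assms(2,3,1)]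
  by (intro ext) (auto simp: add_divide_distrib ring_distribs sum.distrib)

lemma taylor_op_cmult:
  assumes "open G" "f holomorphic_on G"
  shows "taylor_op G n (\<lambda>z. c * f z) = (\<lambda>z. c * taylor_op G n f z)"
  unfolding taylor_op_def
  using higher_deriv_cmult[OF assms(2) _ assms(1)]
  by (intro ext) (auto simp: sum_distrib_left mult_ac)

lemma taylor_op_diff:
  assumes "open G" "f holomorphic_on G" "g holomorphic_on G"
  shows "taylor_op G n (\<lambda>z. f z - g z) = (\<lambda>z. taylor_op G n f z - taylor_op G n g z)"
  unfolding taylor_op_def
  using higher_deriv_diff[OF assms(2,3,1)]
  by (intro ext) (auto simp: diff_divide_distrib ring_distribs sum_subtractf)

lemma taylor_op_in_hol_space:
  assumes "open G" "f holomorphic_on G"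
  shows "taylor_op G n f \<in> hol_space G"
proof -
  have "(\<lambda>\<zeta>. \<Sum>j=0..n. (deriv ^^ j) f \<zeta> / fact j * (- \<zeta>) ^ j) holomorphic_on G"
    by (intro holomorphic_intros holomorphic_higher_deriv assms) auto
  then show ?thesis using cut_in_hol_space unfolding taylor_op_def cut_def by blast
qed

text \<open>
  By Cauchy's inequality each of the \<open>n + 1\<close> Taylor terms is at most \<open>B * M ^ n\<close>; the factor \<open>n + 1\<close> is
  absorbed by \<open>2 ^ n\<close> to leave a purely geometric bound.
\<close>

lemma norm_taylor_op_le:
  assumes G: "open G" and f: "f holomorphic_on G" and \<zeta>: "cball \<zeta> d \<subseteq> G" "d > 0"
    and B: "\<And>z. z \<in> cball \<zeta> d \<Longrightarrow> norm (f z) \<le> B" and M: "norm \<zeta> \<le> M * d" "1 \<le> M"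
  shows "norm (taylor_op G n f \<zeta>) \<le> B * (2 * M) ^ n"
proof -
  have "\<zeta> \<in> G" using \<zeta> by auto
  have B0: "0 \<le> B" using B[of \<zeta>] \<zeta>(2) by (auto intro: order_trans[OF norm_ge_zero])
  have hol: "f holomorphic_on ball \<zeta> d" "continuous_on (cball \<zeta> d) f"
    using holomorphic_on_subset[OF f] \<zeta>(1) ball_subset_cball
    by (blast, blast intro: holomorphic_on_imp_continuous_on)
  have "norm ((deriv ^^ j) f \<zeta> / fact j * (- \<zeta>) ^ j) \<le> B * M ^ n" if "j \<in> {0..n}" for j
  proof -
    have "norm ((deriv ^^ j) f \<zeta>) \<le> fact j * B / d ^ j"
      by (rule Cauchy_inequality[OF hol \<zeta>(2)]) (auto intro!: B simp: dist_norm)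
    then have "norm ((deriv ^^ j) f \<zeta> / fact j) \<le> B / d ^ j"
      by (simp add: norm_divide field_simps)
    moreover have "norm ((- \<zeta>) ^ j) \<le> (M * d) ^ j"
      using M by (simp add: norm_power power_mono)
    ultimately have "norm ((deriv ^^ j) f \<zeta> / fact j * (- \<zeta>) ^ j) \<le> B / d ^ j * (M * d) ^ j"
      unfolding norm_mult by (intro mult_mono) (use B0 \<zeta>(2) in auto)
    also have "\<dots> = B * M ^ j" using \<zeta>(2) by (simp add: power_mult_distrib)
    also have "\<dots> \<le> B * M ^ n"
      by (intro mult_left_mono power_increasing) (use that B0 M in auto)
    finally show ?thesis .
  qed
  then have "norm (\<Sum>j=0..n. (deriv ^^ j) f \<zeta> / fact j * (- \<zeta>) ^ j) \<le> of_nat (Suc n) * (B * M ^ n)"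
    using sum_norm_bound[of "{0..n}" "\<lambda>j. (deriv ^^ j) f \<zeta> / fact j * (- \<zeta>) ^ j" "B * M ^ n"]
    by simp
  also have "\<dots> \<le> 2 ^ n * (B * M ^ n)"
    using of_nat_mono[OF Suc_leI[OF less_exp[of n]], where ?'a = real] B0 M(2)
    by (intro mult_right_mono) auto
  finally show ?thesis
    using \<open>\<zeta> \<in> G\<close> by (simp add: taylor_op_def power_mult_distrib mult_ac)
qed

text \<open>
  The constants \<open>K'\<close> and \<open>A\<close> depend on \<open>K\<close> alone and serve for all functions and all orders. For fixed
  \<open>n\<close> this is continuity of the operator; as \<open>n\<close> varies it says that an error in \<open>f\<close> is amplified
  at most geometrically.
\<close>

lemma taylor_op_compact_bound:
  assumes G: "open G" and K: "compact K" "K \<subseteq> G"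
  obtains K' A where "compact K'" "K \<subseteq> K'" "K' \<subseteq> G" "A > 0"
    "\<forall>f B n. f holomorphic_on G \<longrightarrow> (\<forall>z\<in>K'. norm (f z) \<le> B) \<longrightarrow>
       (\<forall>\<zeta>\<in>K. norm (taylor_op G n f \<zeta>) \<le> B * A ^ n)"
proof -
  obtain d where d: "d > 0" "(\<Union>x\<in>K. cball x d) \<subseteq> G"
    using compact_subset_open_imp_cball_epsilon_subset[OF K(1) G K(2)] by blast
  obtain R where R: "R > 0" "\<And>z. z \<in> K \<Longrightarrow> norm z \<le> R"
    using compact_imp_bounded[OF K(1)] unfolding bounded_pos by blast
  define K' where "K' = {x + y |x y. x \<in> K \<and> y \<in> cball 0 d}"
  have K': "K' = (\<Union>x\<in>K. cball x d)"
  proof (intro equalityI subsetI)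
    fix w assume "w \<in> (\<Union>x\<in>K. cball x d)"
    then obtain x where x: "x \<in> K" "w \<in> cball x d" by blast
    then have "w = x + (w - x) \<and> x \<in> K \<and> w - x \<in> cball 0 d" by (simp add: dist_norm norm_minus_commute)
    then show "w \<in> K'" unfolding K'_def by blast
  qed (auto simp: K'_def, metis add_diff_cancel_left' dist_norm norm_minus_commute)
  show thesis
  proof (rule that[of K' "2 * max 1 (R / d)"]; (intro allI impI ballI)?)
    show "compact K'" unfolding K'_def by (intro compact_sums K compact_cball)
    show "K \<subseteq> K'" using d(1) by (auto simp: K')
    show "K' \<subseteq> G" using d(2) by (simp add: K')
    fix f B n \<zeta> assume f: "f holomorphic_on G" "\<forall>z\<in>K'. norm (f z) \<le> B" and \<zeta>: "\<zeta> \<in> K"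
    have "norm \<zeta> \<le> max 1 (R / d) * d"
      using R(2)[OF \<zeta>] d(1) by (simp add: max_def field_simps)
    then show "norm (taylor_op G n f \<zeta>) \<le> B * (2 * max 1 (R / d)) ^ n"
      using d \<zeta> f(2) by (intro norm_taylor_op_le G f(1)) (auto simp: K')
  qed simp
qed

lemma higher_deriv_poly: "(deriv ^^ j) (poly p) = poly ((pderiv ^^ j) p)" for p :: "complex poly"
  by (induction j) (auto intro!: DERIV_imp_deriv poly_DERIV)

text \<open>
  The Taylor expansion of a polynomial about \<open>\<zeta>\<close> is finite, and at the point \<open>0\<close> it returns the value there.
\<close>

lemma taylor_op_poly:
  assumes "\<zeta> \<in> G" "degree p \<le> n"
  shows "taylor_op G n (poly p) \<zeta> = poly p 0"
proof -
  let ?t = "\<lambda>j. (deriv ^^ j) (poly p) \<zeta> / fact j * (0 - \<zeta>) ^ j"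
  have "?t sums poly p 0"
    by (rule holomorphic_power_series[where r = "norm \<zeta> + 1"])
       (auto intro!: holomorphic_intros simp: dist_norm)
  moreover have "?t j = 0" if "j \<notin> {0..n}" for j
  proof -
    have "(pderiv ^^ Suc (degree p)) p = 0"
      using degree_higher_pderiv[of "degree p" p] by (auto elim: degree_eq_zeroE)
    moreover have "j = (j - Suc (degree p)) + Suc (degree p)" using that assms(2) by simp
    ultimately have "(pderiv ^^ j) p = 0"
      by (metis funpow_add higher_pderiv_0 o_apply)
    then show ?thesis by (simp add: higher_deriv_poly)
  qed
  then have "?t sums sum ?t {0..n}" by (intro sums_finite) auto
  ultimately show ?thesis
    using assms(1) sums_unique2 unfolding taylor_op_def by fastforce
qed

lemma higher_deriv_inverse_power:
  "\<zeta> \<noteq> 0 \<Longrightarrow> (deriv ^^ j) (\<lambda>z. inverse z ^ Suc r) \<zeta>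
     = (- 1) ^ j * fact j * of_nat (r + j choose j) * inverse (\<zeta> :: complex) ^ (Suc r + j)"
proof (induction j arbitrary: \<zeta>)
  case (Suc j)
  define c :: complex where "c = (- 1) ^ j * fact j * of_nat (r + j choose j)"
  have "((\<lambda>z. inverse z ^ Suc k) has_field_derivative
      - of_nat (Suc k) * inverse \<zeta> ^ Suc (Suc k)) (at \<zeta>)" for k
    using DERIV_power[OF DERIV_inverse[OF Suc.prems, of UNIV], of "Suc k"]
    by (simp add: mult_ac del: of_nat_Suc)
  from DERIV_cmult[OF this[of "r + j"], of c]
  have "((deriv ^^ j) (\<lambda>z. inverse z ^ Suc r) has_field_derivative
      c * (- of_nat (Suc (r + j)) * inverse \<zeta> ^ Suc (Suc (r + j)))) (at \<zeta>)"
    by (rule has_field_derivative_transform_within_open[where S = "- {0}"])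
       (use Suc in \<open>auto simp: c_def\<close>)
  then have "(deriv ^^ Suc j) (\<lambda>z. inverse z ^ Suc r) \<zeta>
      = c * (- of_nat (Suc (r + j)) * inverse \<zeta> ^ Suc (Suc (r + j)))"
    unfolding funpow.simps o_apply by (rule DERIV_imp_deriv)
  also have "\<dots> = (- 1) ^ Suc j * fact j * (of_nat (Suc (r + j)) * of_nat (r + j choose j))
      * inverse \<zeta> ^ (Suc r + Suc j)"
    by (simp add: c_def mult_ac del: of_nat_Suc)
  also have "of_nat (Suc (r + j)) * of_nat (r + j choose j)
      = (of_nat (Suc j) * of_nat (r + Suc j choose Suc j) :: complex)"
    using Suc_times_binomial[of j "r + j"]
    by (simp only: of_nat_eq_iff add_Suc_right flip: of_nat_mult)
  finally show ?case by (simp only: fact_Suc of_nat_mult of_nat_fact mult_ac)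
qed simp

text \<open>
  Negative powers are eigenvectors: the \<open>j\<close>-th Taylor term is \<open>r + j choose j\<close> times the function itself,
  and the eigenvalue is the sum of these binomial coefficients along a diagonal of Pascal's triangle.
\<close>

lemma taylor_op_inverse_power:
  assumes "\<zeta> \<in> G" "0 \<notin> G"
  shows "taylor_op G n (\<lambda>z. inverse z ^ Suc r) \<zeta> = of_nat (Suc (r + n) choose n) * inverse \<zeta> ^ Suc r"
proof -
  have nz: "\<zeta> \<noteq> 0" using assms by auto
  have "(deriv ^^ j) (\<lambda>z. inverse z ^ Suc r) \<zeta> / fact j * (- \<zeta>) ^ j
      = of_nat (r + j choose j) * inverse \<zeta> ^ Suc r" for j
  proof -
    have "inverse \<zeta> ^ j * (- \<zeta>) ^ j = (- 1) ^ j"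
      using nz by (simp flip: power_mult_distrib)
    then have "(- 1) ^ j * (inverse \<zeta> ^ j * (- \<zeta>) ^ j) = 1"
      by (simp flip: power_mult_distrib)
    then show ?thesis
      unfolding higher_deriv_inverse_power[OF nz] power_add
      by (simp add: mult_ac del: power_Suc)
  qed
  then show ?thesis
    using assms(1) sum_choose_lower[of r n]
    by (simp add: taylor_op_def atLeast0AtMost flip: sum_distrib_right of_nat_sum del: power_Suc)
qed

text \<open>
  The eigenvalue is \<open>(n + 1) (n + 2) \<dots> (n + r + 1) / (r + 1)!\<close>. In the quotient of the eigenvalues for
  \<open>a \<le> b\<close> all factors are at most \<open>1\<close>, and the first of them already gives \<open>(a + 1) / (b + 1)\<close>.
\<close>

lemma eigenvalue_ratio:
  assumes "a \<le> b"
  shows "(Suc (r + a) choose a) * Suc b \<le> (Suc (r + b) choose b) * Suc a"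
proof (induction r)
  case (Suc r)
  have step: "(r + 2) * (Suc (Suc r + n) choose n) = (r + n + 2) * (Suc (r + n) choose n)" for n
    using binomial_absorb_comp[of "Suc (Suc r + n)" n] by simp
  have "(r + 2) * ((Suc (Suc r + a) choose a) * Suc b) = (r + a + 2) * ((Suc (r + a) choose a) * Suc b)"
    using step[of a] by (simp only: mult.assoc[symmetric])
  also have "\<dots> \<le> (r + b + 2) * ((Suc (r + b) choose b) * Suc a)"
    using assms by (intro mult_le_mono[OF _ Suc.IH]) simp
  also have "\<dots> = (r + 2) * ((Suc (Suc r + b) choose b) * Suc a)"
    using step[of b] by (simp only: mult.assoc[symmetric])
  finally show ?case by (metis add_gr_0 mult_le_cancel1 zero_less_numeral)
qed simp

section \<open>Polynomials close to a negative power at a geometric rate\<close>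

lemma uniform_limit_majorant:
  fixes f :: "nat \<Rightarrow> complex \<Rightarrow> complex"
  assumes "\<forall>\<^sub>F n in sequentially. \<forall>z\<in>K. norm (f n z - g z) \<le> b n" "b \<longlonglongrightarrow> 0"
  shows "uniform_limit K f g sequentially"
  unfolding uniform_limit_iff
proof (intro allI impI)
  fix e :: real assume "e > 0"
  then have "\<forall>\<^sub>F n in sequentially. b n < e" using assms(2) by (simp add: order_tendstoD)
  with assms(1) show "\<forall>\<^sub>F n in sequentially. \<forall>z\<in>K. dist (f n z) (g z) < e"
    by eventually_elim (auto simp: dist_norm intro: le_less_trans)
qed

text \<open>
  Mere approximability of \<open>inverse\<close> improves itself to a rate: from one polynomial \<open>p\<close> such that
  \<open>u = 1 - z p\<close> has modulus at most \<open>1 / 2\<close> on \<open>K\<close>, the quotients \<open>Q k = (1 - u ^ k) / z\<close> are polynomials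
  of degree \<open>O(k)\<close> with \<open>\<bar>z Q k - 1\<bar> \<le> (1 / 2) ^ k\<close>. To approximate \<open>inverse z ^ m\<close> by a polynomial that
  vanishes at \<open>0\<close>, take \<open>z * Q k ^ (m + 1)\<close>; it equals \<open>inverse z ^ m * (z Q k) ^ (m + 1)\<close>.
\<close>

lemma geometric_poly_approx_inverse_power:
  assumes K: "compact K" "0 \<notin> K" and inv: "poly_approx K inverse"
  obtains C D where "\<forall>k\<ge>1. \<exists>P. degree P \<le> D * k \<and> poly P 0 = 0 \<and>
    (\<forall>z\<in>K. norm (poly P z - inverse z ^ m) \<le> C * (1 / 2) ^ k)"
proof -
  obtain R where R: "R > 0" "\<And>z. z \<in> K \<Longrightarrow> norm z \<le> R"
    using compact_imp_bounded[OF K(1)] unfolding bounded_pos by blast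
  obtain M where M: "M > 0" "\<And>z. z \<in> K \<Longrightarrow> norm (inverse z) \<le> M"
    using poly_approx_bounded[OF K(1) inv] by blast
  obtain p where p: "\<forall>z\<in>K. norm (inverse z - poly p z) < 1 / (2 * R)"
    using inv R(1) unfolding poly_approx_def by (meson divide_pos_pos mult_pos_pos zero_less_numeral zero_less_one)
  define d where "d = Suc (degree p)"
  define u where "u = 1 - [:0, 1:] * p"
  have u_deg: "degree u \<le> d"
  proof -
    have "degree ([:0, 1:] * p) \<le> d"
      using degree_mult_le[of "[:0, 1:]" p] by (simp add: d_def)
    then show ?thesis unfolding u_def by (intro degree_diff_le) auto
  qed
  have u_le: "norm (poly u z) \<le> 1 / 2" if "z \<in> K" for z
  proof -
    have "z \<noteq> 0" using that K(2) by auto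
    then have "poly u z = z * (inverse z - poly p z)" by (simp add: u_def algebra_simps)
    then have "norm (poly u z) = norm z * norm (inverse z - poly p z)" by (simp add: norm_mult)
    also have "\<dots> \<le> R * (1 / (2 * R))"
      by (intro mult_mono R that less_imp_le[OF p[rule_format]]) (use R(1) in auto)
    finally show ?thesis using R(1) by simp
  qed
  define s where "s = Suc m"
  define Q where "Q = (\<lambda>k. p * (\<Sum>i<k. u ^ i))"
  define P where "P = (\<lambda>k. [:0, 1:] * Q k ^ s)"
  have zQ: "z * poly (Q k) z = 1 - poly u z ^ k" for z k
  proof -
    have "poly (1 - u ^ k) z = poly ((1 - u) * (\<Sum>i<k. u ^ i)) z"
      by (simp only: one_diff_power_eq)
    then show ?thesis by (simp add: Q_def u_def mult_ac)
  qed
  have "degree (P k) \<le> (1 + 2 * d * s) * k \<and> poly (P k) 0 = 0 \<and>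
    (\<forall>z\<in>K. norm (poly (P k) z - inverse z ^ m) \<le> M ^ m * (2 ^ s * s) * (1 / 2) ^ k)"
    if k: "k \<ge> 1" for k
  proof (intro conjI ballI)
    have "degree (u ^ i) \<le> d * k" if "i \<in> {..<k}" for i
    proof -
      have "degree (u ^ i) \<le> degree u * i" by (rule degree_power_le)
      also have "\<dots> \<le> d * k" using u_deg that by (intro mult_le_mono) auto
      finally show ?thesis .
    qed
    then have "degree (\<Sum>i<k. u ^ i) \<le> d * k" by (intro degree_sum_le) auto
    then have "degree (Q k) \<le> degree p + d * k"
      unfolding Q_def using degree_mult_le[of p "\<Sum>i<k. u ^ i"] by linarith
    also have "\<dots> \<le> d * k + d * k"
      using mult_le_mono2[OF k, of d] by (simp add: d_def)
    finally have "degree (Q k) \<le> 2 * d * k" by simp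
    then have "degree (Q k ^ s) \<le> 2 * d * k * s"
      using degree_power_le[of "Q k" s] by (meson le_trans mult_le_mono1)
    then have "degree (P k) \<le> 1 + 2 * d * k * s"
      unfolding P_def using degree_mult_le[of "[:0, 1:]" "Q k ^ s"] by simp
    also have "\<dots> \<le> (1 + 2 * d * s) * k" using k by (simp add: algebra_simps)
    finally show "degree (P k) \<le> (1 + 2 * d * s) * k" .
    show "poly (P k) 0 = 0" by (simp add: P_def)
  next
    fix z assume z: "z \<in> K"
    then have "z \<noteq> 0" using K(2) by auto
    define v where "v = 1 - poly u z ^ k"
    have vk: "norm (poly u z ^ k) \<le> (1 / 2) ^ k"
      using u_le[OF z] by (simp add: norm_power power_mono)
    also have "(1 / 2) ^ k \<le> (1 :: real)" by (simp add: power_le_one)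
    finally have v: "norm v \<le> 2" unfolding v_def using norm_triangle_ineq4[of 1 "poly u z ^ k"] by simp
    have "poly (P k) z = z * poly (Q k) z ^ s" by (simp add: P_def)
    also have "\<dots> = inverse z ^ m * (z * poly (Q k) z) ^ s"
      using \<open>z \<noteq> 0\<close> by (simp add: s_def power_mult_distrib field_simps)
    finally have "poly (P k) z - inverse z ^ m = - (inverse z ^ m * (1 - v ^ s))"
      by (simp add: zQ v_def algebra_simps)
    also have "\<dots> = - (inverse z ^ m * (poly u z ^ k * (\<Sum>i<s. v ^ i)))"
      using one_diff_power_eq[of v s] by (simp add: v_def)
    finally have "norm (poly (P k) z - inverse z ^ m)
        = norm (inverse z) ^ m * (norm (poly u z ^ k) * norm (\<Sum>i<s. v ^ i))"
      by (simp add: norm_mult norm_power)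
    also have "\<dots> \<le> M ^ m * ((1 / 2) ^ k * (s * 2 ^ s))"
    proof (intro mult_mono power_mono M z vk)
      have "norm (v ^ i) \<le> 2 ^ s" if "i \<in> {..<s}" for i
      proof -
        have "norm (v ^ i) \<le> 2 ^ i" using v by (simp add: norm_power power_mono)
        also have "(2 :: real) ^ i \<le> 2 ^ s" using that by (intro power_increasing) auto
        finally show ?thesis .
      qed
      then show "norm (\<Sum>i<s. v ^ i) \<le> s * 2 ^ s"
        using sum_norm_bound[of "{..<s}" "\<lambda>i. v ^ i" "2 ^ s"] by simp
    qed (use M(1) in auto)
    finally show "norm (poly (P k) z - inverse z ^ m) \<le> M ^ m * (2 ^ s * s) * (1 / 2) ^ k"
      by (simp add: mult_ac)
  qed
  then show thesis by (intro that[of "1 + 2 * d * s" "M ^ m * (2 ^ s * s)"]) blast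
qed

section \<open>Steering two Taylor operators at once\<close>

text \<open>
  The pairs of targets that perturbations tending to zero reach in the limit, uniformly on \<open>K\<close>.
  These pairs form a linear space, so it is enough to reach \<open>(inverse z ^ m, 0)\<close> and \<open>(0, inverse z ^ m)\<close>.
\<close>

definition steerable ::
    "complex set \<Rightarrow> complex set \<Rightarrow> (nat \<Rightarrow> nat) \<Rightarrow> (nat \<Rightarrow> nat) \<Rightarrow> (complex \<Rightarrow> complex) \<Rightarrow> (complex \<Rightarrow> complex) \<Rightarrow> bool"
  where "steerable G K a b g1 g2 \<longleftrightarrow> (\<exists>h. (\<forall>n. h n holomorphic_on G) \<and>
     uniform_limit K h (\<lambda>z. 0) sequentially \<and>
     uniform_limit K (\<lambda>n. taylor_op G (a n) (h n)) g1 sequentially \<and>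
     uniform_limit K (\<lambda>n. taylor_op G (b n) (h n)) g2 sequentially)"

lemma steerable_zero: "steerable G K a b (\<lambda>z. 0) (\<lambda>z. 0)"
proof -
  have "taylor_op G n (\<lambda>z. 0) = (\<lambda>z. 0)" for n
    by (auto simp: taylor_op_def)
  then show ?thesis
    unfolding steerable_def
    by (intro exI[of _ "\<lambda>n z. 0"]) (auto intro!: uniform_limit_const)
qed

lemma steerable_add:
  assumes G: "open G" and "steerable G K a b f1 f2" "steerable G K a b g1 g2"
  shows "steerable G K a b (\<lambda>z. f1 z + g1 z) (\<lambda>z. f2 z + g2 z)"
proof -
  obtain h k where h: "\<And>n. h n holomorphic_on G" "uniform_limit K h (\<lambda>z. 0) sequentially"
      "uniform_limit K (\<lambda>n. taylor_op G (a n) (h n)) f1 sequentially"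
      "uniform_limit K (\<lambda>n. taylor_op G (b n) (h n)) f2 sequentially"
    and k: "\<And>n. k n holomorphic_on G" "uniform_limit K k (\<lambda>z. 0) sequentially"
      "uniform_limit K (\<lambda>n. taylor_op G (a n) (k n)) g1 sequentially"
      "uniform_limit K (\<lambda>n. taylor_op G (b n) (k n)) g2 sequentially"
    using assms(2,3) unfolding steerable_def by blast
  show ?thesis
    unfolding steerable_def
  proof (intro exI[of _ "\<lambda>n z. h n z + k n z"] conjI allI)
    show "(\<lambda>z. h n z + k n z) holomorphic_on G" for n by (intro holomorphic_intros h k)
  qed (use h k uniform_limit_add[OF h(2) k(2)] in
        \<open>auto simp: taylor_op_add[OF G] intro!: uniform_limit_add\<close>)
qed

lemma steerable_cmult:
  assumes G: "open G" and "steerable G K a b g1 g2"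
  shows "steerable G K a b (\<lambda>z. c * g1 z) (\<lambda>z. c * g2 z)"
proof -
  obtain h where h: "\<And>n. h n holomorphic_on G" "uniform_limit K h (\<lambda>z. 0) sequentially"
      "uniform_limit K (\<lambda>n. taylor_op G (a n) (h n)) g1 sequentially"
      "uniform_limit K (\<lambda>n. taylor_op G (b n) (h n)) g2 sequentially"
    using assms(2) unfolding steerable_def by blast
  have lim: "uniform_limit K (\<lambda>n z. c * f n z) (\<lambda>z. c * g z) sequentially"
    if "uniform_limit K f g sequentially" for f and g :: "complex \<Rightarrow> complex"
    by (rule bounded_linear.uniform_limit[OF bounded_linear_mult_right that])
  show ?thesis
    unfolding steerable_def
  proof (intro exI[of _ "\<lambda>n z. c * h n z"] conjI allI)
    show "(\<lambda>z. c * h n z) holomorphic_on G" for n by (intro holomorphic_intros h)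
  qed (use h lim[OF h(2)] in \<open>auto simp: taylor_op_cmult[OF G] intro!: lim\<close>)
qed

lemma steerable_sum:
  assumes "open G" "\<And>i. i \<in> I \<Longrightarrow> steerable G K a b (f i) (g i)"
  shows "steerable G K a b (\<lambda>z. \<Sum>i\<in>I. f i z) (\<lambda>z. \<Sum>i\<in>I. g i z)"
  using assms(2)
  by (induction I rule: infinite_finite_induct) (auto intro: steerable_zero steerable_add assms(1))

lemma one_le_eigenvalue: "Suc n \<le> (Suc (r + n) choose n)"
  using eigenvalue_ratio[of 0 n r] by simp

lemma eigenvalue_ratio_tendsto_0:
  assumes "filterlim a at_top sequentially" "filterlim (\<lambda>n. real (b n) / real (a n)) at_top sequentially"
  shows "(\<lambda>n. real (Suc (r + a n) choose a n) / real (Suc (r + b n) choose b n)) \<longlonglongrightarrow> 0"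
proof (rule Lim_null_comparison)
  have "\<forall>\<^sub>F n in sequentially. real (b n) / real (a n) \<ge> 1"
    using assms(2) by (simp add: filterlim_at_top)
  moreover have "\<forall>\<^sub>F n in sequentially. a n \<ge> 1"
    using assms(1) by (simp add: filterlim_at_top)
  ultimately show "\<forall>\<^sub>F n in sequentially.
      norm (real (Suc (r + a n) choose a n) / real (Suc (r + b n) choose b n)) \<le> 2 / (real (b n) / real (a n))"
  proof eventually_elim
    case (elim n)
    then have ab: "a n \<le> b n" by (simp add: field_simps)
    have "real (Suc (r + a n) choose a n) * real (Suc (b n)) \<le> real (Suc (r + b n) choose b n) * real (Suc (a n))"
      using eigenvalue_ratio[OF ab, of r] by (simp only: of_nat_le_iff flip: of_nat_mult)
    moreover have "real (Suc (r + b n) choose b n) > 0" by simp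
    ultimately have "real (Suc (r + a n) choose a n) / real (Suc (r + b n) choose b n) \<le> real (Suc (a n)) / real (Suc (b n))"
      by (simp add: divide_simps mult_ac del: binomial_Suc_Suc)
    also have "\<dots> \<le> (2 * real (a n)) / real (b n)"
      using elim ab by (intro frac_le) auto
    also have "\<dots> = 2 / (real (b n) / real (a n))" by simp
    finally show ?case by (simp del: binomial_Suc_Suc)
  qed
  show "(\<lambda>n. 2 / (real (b n) / real (a n))) \<longlonglongrightarrow> 0"
    by (rule tendsto_divide_0[OF tendsto_const filterlim_at_top_imp_at_infinity[OF assms(2)]])
qed

lemma inverse_eigenvalue_tendsto_0:
  assumes "filterlim a at_top sequentially"
  shows "(\<lambda>n. 1 / real (Suc (r + a n) choose a n)) \<longlonglongrightarrow> 0"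
proof (rule Lim_null_comparison)
  have "1 / real (Suc (r + m) choose m) \<le> inverse (real (Suc m))" for m
    using of_nat_mono[OF one_le_eigenvalue[of m r], where ?'a = real]
    by (simp add: field_simps del: binomial_Suc_Suc of_nat_Suc)
  then show "\<forall>\<^sub>F n in sequentially. norm (1 / real (Suc (r + a n) choose a n)) \<le> inverse (real (Suc (a n)))"
    by (simp del: binomial_Suc_Suc of_nat_Suc)
  show "(\<lambda>n. inverse (real (Suc (a n)))) \<longlonglongrightarrow> 0"
    by (rule filterlim_compose[OF LIMSEQ_inverse_real_of_nat assms])
qed

lemma compact_norm_inverse_bound:
  assumes "compact K" "0 \<notin> (K :: complex set)"
  obtains M where "M > 0" "\<And>z. z \<in> K \<Longrightarrow> norm (inverse z ^ m) \<le> M"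
proof -
  have "compact ((\<lambda>z. inverse z ^ m) ` K)"
    using assms by (intro compact_continuous_image continuous_intros) auto
  from compact_imp_bounded[OF this]
  obtain M where "M > 0" "\<forall>w\<in>(\<lambda>z. inverse z ^ m) ` K. norm w \<le> M"
    unfolding bounded_pos by blast
  then show thesis by (intro that[of M]) auto
qed

text \<open>
  Divide the target by its eigenvalue of order \<open>b n\<close>. The first operator then multiplies it by a
  quotient of eigenvalues of orders \<open>a n\<close> and \<open>b n\<close>, which tends to \<open>0\<close>.
\<close>

lemma steerable_second:
  assumes G: "open G" "0 \<notin> G" and K: "compact K" "K \<subseteq> G"
    and a: "filterlim a at_top sequentially"
    and b: "filterlim b at_top sequentially"
    and ratio: "filterlim (\<lambda>n. real (b n) / real (a n)) at_top sequentially"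
  shows "steerable G K a b (\<lambda>z. 0) (\<lambda>z. inverse z ^ Suc r)"
proof -
  obtain M where M: "M > 0" "\<And>z. z \<in> K \<Longrightarrow> norm (inverse z ^ Suc r) \<le> M"
    using compact_norm_inverse_bound[OF K(1), of "Suc r"] K(2) G(2) by blast
  define e where "e = (\<lambda>n. Suc (r + n) choose n)"
  have e: "e n \<noteq> 0" for n by (simp add: e_def del: binomial_Suc_Suc)
  have hol: "(\<lambda>z. inverse z ^ Suc r) holomorphic_on G"
    using G(2) by (intro holomorphic_intros) auto
  define h where "h = (\<lambda>n z. 1 / of_nat (e (b n)) * inverse z ^ Suc r :: complex)"
  have T: "taylor_op G m (h n) z = of_nat (e m) / of_nat (e (b n)) * inverse z ^ Suc r" if "z \<in> K" for m n z
    unfolding h_def taylor_op_cmult[OF G(1) hol] e_def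
    using that K G(2) by (subst taylor_op_inverse_power) auto
  show ?thesis
    unfolding steerable_def
  proof (intro exI[of _ h] conjI allI)
    show "h n holomorphic_on G" for n
      unfolding h_def by (intro holomorphic_on_mult holomorphic_on_const hol)
    show "uniform_limit K h (\<lambda>z. 0) sequentially"
    proof (rule uniform_limit_majorant)
      show "(\<lambda>n. 1 / real (e (b n)) * M) \<longlonglongrightarrow> 0"
        unfolding e_def by (intro tendsto_mult_left_zero inverse_eigenvalue_tendsto_0 b)
      show "\<forall>\<^sub>F n in sequentially. \<forall>z\<in>K. norm (h n z - 0) \<le> 1 / real (e (b n)) * M"
        using M by (intro always_eventually) (auto simp: h_def norm_mult norm_divide divide_right_mono simp del: power_Suc)
    qed
    show "uniform_limit K (\<lambda>n. taylor_op G (a n) (h n)) (\<lambda>z. 0) sequentially"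
    proof (rule uniform_limit_majorant)
      show "(\<lambda>n. real (e (a n)) / real (e (b n)) * M) \<longlonglongrightarrow> 0"
        unfolding e_def by (intro tendsto_mult_left_zero eigenvalue_ratio_tendsto_0 a ratio)
      show "\<forall>\<^sub>F n in sequentially. \<forall>z\<in>K. norm (taylor_op G (a n) (h n) z - 0) \<le> real (e (a n)) / real (e (b n)) * M"
        using M by (intro always_eventually)
          (auto simp: T norm_mult norm_divide divide_right_mono mult_left_mono simp del: power_Suc)
    qed
    show "uniform_limit K (\<lambda>n. taylor_op G (b n) (h n)) (\<lambda>z. inverse z ^ Suc r) sequentially"
      by (rule uniform_limit_majorant[where b = "\<lambda>_. 0"]) (auto simp: T e simp del: power_Suc)
  qed
qed

text \<open>
  Dividing the target by its eigenvalue of order \<open>a n\<close> would make the second operator explode.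
  So the negative power is first replaced by a polynomial \<open>P n\<close> of degree at most \<open>b n\<close> that vanishes at
  \<open>0\<close>: the second operator annihilates it. The first operator amplifies the error of this replacement by
  at most \<open>A ^ a n\<close>, which an error of order \<open>(1 / 2) ^ (N * a n)\<close> with \<open>2 ^ N \<ge> 2 * A\<close> outweighs. The degree
  needed for such an error is \<open>O(a n)\<close>, and this stays below \<open>b n\<close> because \<open>b n / a n\<close> tends to infinity.
\<close>

lemma steerable_first:
  assumes G: "open G" "simply_connected G" "0 \<notin> G" and K: "compact K" "K \<subseteq> G"
    and a: "filterlim a at_top sequentially"
    and ratio: "filterlim (\<lambda>n. real (b n) / real (a n)) at_top sequentially"
  shows "steerable G K a b (\<lambda>z. inverse z ^ Suc r) (\<lambda>z. 0)"
proof -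
  obtain K' A where K': "compact K'" "K \<subseteq> K'" "K' \<subseteq> G" and A: "A > 0"
    and bound: "\<forall>f B n. f holomorphic_on G \<longrightarrow> (\<forall>z\<in>K'. norm (f z) \<le> B) \<longrightarrow>
       (\<forall>\<zeta>\<in>K. norm (taylor_op G n f \<zeta>) \<le> B * A ^ n)"
    by (rule taylor_op_compact_bound[OF G(1) K])
  have "0 \<notin> K'" using K' G(3) by auto
  obtain M where M: "M > 0" "\<And>z. z \<in> K' \<Longrightarrow> norm (inverse z ^ Suc r) \<le> M"
    using compact_norm_inverse_bound[OF K'(1) \<open>0 \<notin> K'\<close>] by blast
  have hol: "(\<lambda>z. inverse z ^ Suc r) holomorphic_on G" "inverse holomorphic_on G"
    using G(3) by (auto intro!: holomorphic_intros)
  have inv: "poly_approx K' inverse"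
    by (rule runge_simply_connected[OF G(1,2) _ K'(1,3) hol(2)]) (use G(3) in auto)
  obtain C D where CD: "\<forall>k\<ge>1. \<exists>P. degree P \<le> D * k \<and> poly P 0 = 0 \<and>
    (\<forall>z\<in>K'. norm (poly P z - inverse z ^ Suc r) \<le> C * (1 / 2) ^ k)"
    by (rule geometric_poly_approx_inverse_power[OF K'(1) \<open>0 \<notin> K'\<close> inv])
  obtain N where N: "2 * A \<le> 2 ^ N"
    using real_arch_pow[of 2 "2 * A"] by (auto intro: less_imp_le)
  \<comment> \<open>The successor keeps the exponent positive when a n = 0.\<close>
  define k where "k = (\<lambda>n. Suc (N * a n))"
  have "\<forall>n. \<exists>P. degree P \<le> D * k n \<and> poly P 0 = 0 \<and>
    (\<forall>z\<in>K'. norm (poly P z - inverse z ^ Suc r) \<le> C * (1 / 2) ^ k n)"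
    by (intro allI CD[rule_format]) (simp add: k_def)
  then obtain P where P: "\<And>n. degree (P n) \<le> D * k n" "\<And>n. poly (P n) 0 = 0"
    "\<And>n z. z \<in> K' \<Longrightarrow> norm (poly (P n) z - inverse z ^ Suc r) \<le> C * (1 / 2) ^ k n"
    by metis
  define e where "e = (\<lambda>n. Suc (r + n) choose n)"
  have e: "e n \<noteq> 0" "e n \<ge> 1" for n
    using one_le_eigenvalue[of n r] by (simp_all add: e_def del: binomial_Suc_Suc)
  define h where "h = (\<lambda>n z. 1 / of_nat (e (a n)) * poly (P n) z :: complex)"
  have P_hol: "poly (P n) holomorphic_on G" for n by (intro holomorphic_intros)
  show ?thesis
    unfolding steerable_def
  proof (intro exI[of _ h] conjI allI)
    show "h n holomorphic_on G" for n
      unfolding h_def by (intro holomorphic_on_mult holomorphic_on_const P_hol)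
    show "uniform_limit K h (\<lambda>z. 0) sequentially"
    proof (rule uniform_limit_majorant)
      show "(\<lambda>n. 1 / real (e (a n)) * (\<bar>C\<bar> + M)) \<longlonglongrightarrow> 0"
        unfolding e_def by (intro tendsto_mult_left_zero inverse_eigenvalue_tendsto_0 a)
      have "norm (h n z - 0) \<le> 1 / real (e (a n)) * (\<bar>C\<bar> + M)" if z: "z \<in> K" for n z
      proof -
        have z': "z \<in> K'" using z K'(2) by blast
        have "C * (1 / 2) ^ k n \<le> \<bar>C\<bar> * 1"
          by (intro mult_mono power_le_one) auto
        then have "norm (poly (P n) z) \<le> \<bar>C\<bar> + M"
          using P(3)[OF z', of n] M(2)[OF z']
            norm_triangle_ineq[of "poly (P n) z - inverse z ^ Suc r" "inverse z ^ Suc r"]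
          by (simp del: power_Suc)
        then show ?thesis by (simp add: h_def norm_mult norm_divide divide_right_mono)
      qed
      then show "\<forall>\<^sub>F n in sequentially. \<forall>z\<in>K. norm (h n z - 0) \<le> 1 / real (e (a n)) * (\<bar>C\<bar> + M)"
        by (intro always_eventually) blast
    qed
    show "uniform_limit K (\<lambda>n. taylor_op G (a n) (h n)) (\<lambda>z. inverse z ^ Suc r) sequentially"
    proof (rule uniform_limit_majorant)
      have "norm (taylor_op G (a n) (h n) z - inverse z ^ Suc r) \<le> \<bar>C\<bar> * (1 / 2) ^ a n"
        if z: "z \<in> K" for n z
      proof -
        have "z \<in> G" using z K by blast
        let ?d = "taylor_op G (a n) (\<lambda>z. poly (P n) z - inverse z ^ Suc r) z"
        have "taylor_op G (a n) (h n) z = 1 / of_nat (e (a n)) * taylor_op G (a n) (poly (P n)) z"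
          unfolding h_def taylor_op_cmult[OF G(1) P_hol] ..
        also have "taylor_op G (a n) (poly (P n)) z = ?d + of_nat (e (a n)) * inverse z ^ Suc r"
          unfolding taylor_op_diff[OF G(1) P_hol hol(1)] e_def
          using taylor_op_inverse_power[OF \<open>z \<in> G\<close> G(3)] by simp
        finally have "taylor_op G (a n) (h n) z - inverse z ^ Suc r = 1 / of_nat (e (a n)) * ?d"
          using e(1)[of "a n"] by (simp add: field_simps del: power_Suc)
        then have "norm (taylor_op G (a n) (h n) z - inverse z ^ Suc r) = norm ?d / real (e (a n))"
          by (simp add: norm_mult norm_divide)
        also have "\<dots> \<le> norm ?d / 1"
          using e(2)[of "a n"] by (intro divide_left_mono) auto
        also have "\<dots> \<le> (\<bar>C\<bar> * (1 / 2) ^ k n) * A ^ a n"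
          unfolding div_by_1
        proof (rule bound[rule_format, OF _ _ z])
          show "(\<lambda>z. poly (P n) z - inverse z ^ Suc r) holomorphic_on G"
            by (intro holomorphic_on_diff P_hol hol)
          show "norm (poly (P n) w - inverse w ^ Suc r) \<le> \<bar>C\<bar> * (1 / 2) ^ k n" if "w \<in> K'" for w
            by (rule order_trans[OF P(3)[OF that]]) (intro mult_right_mono, auto)
        qed
        also have "\<dots> \<le> (\<bar>C\<bar> * ((1 / 2) ^ N) ^ a n) * A ^ a n"
          using A by (intro mult_right_mono mult_left_mono) (auto simp: k_def simp flip: power_mult)
        also have "\<dots> = \<bar>C\<bar> * (A / 2 ^ N) ^ a n"
          by (simp add: power_divide)
        also have "\<dots> \<le> \<bar>C\<bar> * (1 / 2) ^ a n"
          using A N by (intro mult_left_mono power_mono) (auto simp: field_simps)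
        finally show ?thesis .
      qed
      then show "\<forall>\<^sub>F n in sequentially. \<forall>z\<in>K. norm (taylor_op G (a n) (h n) z - inverse z ^ Suc r) \<le> \<bar>C\<bar> * (1 / 2) ^ a n"
        by (intro always_eventually) blast
      have "(\<lambda>n. (1 / 2 :: real) ^ a n) \<longlonglongrightarrow> 0"
        by (rule filterlim_compose[OF LIMSEQ_realpow_zero a]) auto
      then show "(\<lambda>n. \<bar>C\<bar> * (1 / 2) ^ a n) \<longlonglongrightarrow> 0" by (rule tendsto_mult_right_zero)
    qed
    show "uniform_limit K (\<lambda>n. taylor_op G (b n) (h n)) (\<lambda>z. 0) sequentially"
    proof (rule uniform_limit_majorant[where b = "\<lambda>_. 0"])
      have "\<forall>\<^sub>F n in sequentially. real (b n) / real (a n) \<ge> real (D * Suc N)"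
        using ratio by (simp add: filterlim_at_top)
      moreover have "\<forall>\<^sub>F n in sequentially. a n \<ge> 1"
        using a by (simp add: filterlim_at_top)
      ultimately show "\<forall>\<^sub>F n in sequentially. \<forall>z\<in>K. norm (taylor_op G (b n) (h n) z - 0) \<le> 0"
      proof eventually_elim
        case (elim n)
        have "real (D * Suc N) * real (a n) \<le> real (b n)"
          using elim by (simp add: field_simps)
        then have "D * Suc N * a n \<le> b n" by (simp only: of_nat_le_iff flip: of_nat_mult)
        moreover have "D * k n \<le> D * (Suc N * a n)"
          using elim by (intro mult_le_mono2) (simp add: k_def)
        ultimately have "degree (P n) \<le> b n" using P(1)[of n]
          unfolding mult.assoc by (meson le_trans)
        then show ?case
          using taylor_op_poly[of _ G "P n" "b n"] K(2) P(2)[of n]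
          unfolding h_def taylor_op_cmult[OF G(1) P_hol] by auto
      qed
    qed simp
  qed
qed

lemma steerable_inverse_poly:
  assumes G: "open G" "simply_connected G" "0 \<notin> G" and K: "compact K" "K \<subseteq> G"
    and a: "filterlim a at_top sequentially" and b: "filterlim b at_top sequentially"
    and ratio: "filterlim (\<lambda>n. real (b n) / real (a n)) at_top sequentially"
  shows "steerable G K a b (\<lambda>z. inverse z * poly p (inverse z)) (\<lambda>z. inverse z * poly q (inverse z))"
proof -
  have expand: "inverse z * poly p (inverse z) = (\<Sum>i\<le>degree p. coeff p i * inverse z ^ Suc i)"
    for z :: complex and p
    by (simp add: poly_altdef sum_distrib_left mult_ac)
  have "steerable G K a b
     (\<lambda>z. (\<Sum>i\<le>degree p. coeff p i * inverse z ^ Suc i) + (\<Sum>i\<le>degree q. coeff q i * 0))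
     (\<lambda>z. (\<Sum>i\<le>degree p. coeff p i * 0) + (\<Sum>i\<le>degree q. coeff q i * inverse z ^ Suc i))"
    by (intro steerable_add steerable_sum steerable_cmult steerable_first steerable_second assms)
  then show ?thesis by (simp add: expand del: power_Suc)
qed

section \<open>Simultaneous approximation\<close>

text \<open>
  Runge's theorem for \<open>f z / z\<close>, which is holomorphic as \<open>0\<close> is not in \<open>G\<close>.
\<close>

lemma approx_by_ident_times_poly:
  assumes G: "open G" "simply_connected G" "0 \<notin> G" and K: "compact K" "K \<subseteq> G"
    and f: "f holomorphic_on G" and "e > 0"
  obtains p where "\<forall>z\<in>K. norm (z * poly p z - f z) < e"
proof -
  obtain R where R: "R > 0" "\<And>z. z \<in> K \<Longrightarrow> norm z \<le> R"
    using compact_imp_bounded[OF K(1)] unfolding bounded_pos by blast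
  have "(\<lambda>z. f z / z) holomorphic_on G" using G(3) by (intro holomorphic_intros f) auto
  then have "poly_approx K (\<lambda>z. f z / z)"
    by (intro runge_simply_connected[OF G(1,2) _ K]) (use G(3) in auto)
  then obtain p where p: "\<forall>z\<in>K. norm (f z / z - poly p z) < e / R"
    using \<open>e > 0\<close> R(1) unfolding poly_approx_def by (meson divide_pos_pos)
  have "norm (z * poly p z - f z) < e" if z: "z \<in> K" for z
  proof -
    have "z \<noteq> 0" using z K G(3) by auto
    then have "norm (z * poly p z - f z) = norm z * norm (f z / z - poly p z)"
      by (simp add: norm_minus_commute right_diff_distrib flip: norm_mult)
    also have "\<dots> \<le> R * norm (f z / z - poly p z)" by (intro mult_right_mono R z) simp
    also have "\<dots> < e" using p z R(1) by (simp add: field_simps)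
    finally show ?thesis .
  qed
  then show thesis by (intro that[of p]) blast
qed

text \<open>
  The inversion carries \<open>G\<close> to a simply connected domain that again omits \<open>0\<close>, so this is the previous
  lemma for \<open>f \<circ> inverse\<close>.
\<close>

lemma approx_by_inverse_times_poly:
  assumes G: "open G" "simply_connected G" "0 \<notin> G" and K: "compact K" "K \<subseteq> G"
    and f: "f holomorphic_on G" and "e > 0"
  obtains p where "\<forall>z\<in>K. norm (inverse z * poly p (inverse z) - f z) < e"
proof -
  have nz: "\<And>z. z \<in> G \<Longrightarrow> z \<noteq> 0" using G(3) by auto
  have cont: "continuous_on G inverse" using nz by (intro continuous_intros) auto
  have hol: "f \<circ> inverse holomorphic_on inverse ` G"
    by (rule holomorphic_on_compose_gen[OF _ f]) (use nz in \<open>auto intro!: holomorphic_intros\<close>)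
  have "homeomorphism G (inverse ` G) inverse inverse"
    unfolding homeomorphism_def image_image
    using nz by (auto intro!: continuous_intros)
  then have sc: "simply_connected (inverse ` G)"
    using G(2) homeomorphic_simply_connected unfolding homeomorphic_def by blast
  have op: "open (inverse ` G)"
    by (rule invariance_of_domain[OF cont G(1)]) (simp add: inj_on_def)
  have cK: "compact (inverse ` K)" "inverse ` K \<subseteq> inverse ` G"
    using K by (auto intro!: compact_continuous_image continuous_on_subset[OF cont])
  have "0 \<notin> inverse ` G" using nz by force
  then obtain p where p: "\<forall>w\<in>inverse ` K. norm (w * poly p w - (f \<circ> inverse) w) < e"
    by (rule approx_by_ident_times_poly[OF op sc _ cK hol \<open>e > 0\<close>])
  show thesis by (rule that[of p]) (use p in simp)
qed

text \<open>
  Start from a polynomial close to \<open>f\<close> that vanishes at \<open>0\<close>. Both operators eventually annihilate it,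
  so a small perturbation that steers them to \<open>g1\<close> and \<open>g2\<close> can be added without interference.
\<close>

lemma simultaneous_approximation:
  assumes G: "open G" "simply_connected G" "0 \<notin> G" and K: "compact K" "K \<subseteq> G"
    and a: "filterlim a at_top sequentially" and b: "filterlim b at_top sequentially"
    and ratio: "filterlim (\<lambda>n. real (b n) / real (a n)) at_top sequentially"
    and hol: "f holomorphic_on G" "g1 holomorphic_on G" "g2 holomorphic_on G" and "e > 0"
  obtains n h where "n \<ge> 1" "h holomorphic_on G" "\<forall>z\<in>K. norm (h z - f z) < e"
    "\<forall>z\<in>K. norm (taylor_op G (a n) h z - g1 z) < e"
    "\<forall>z\<in>K. norm (taylor_op G (b n) h z - g2 z) < e"
proof -
  have e2: "e / 2 > 0" using \<open>e > 0\<close> by simp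
  obtain p where p: "\<forall>z\<in>K. norm (z * poly p z - f z) < e / 2"
    by (rule approx_by_ident_times_poly[OF G K hol(1) e2])
  obtain q1 where q1: "\<forall>z\<in>K. norm (inverse z * poly q1 (inverse z) - g1 z) < e / 2"
    by (rule approx_by_inverse_times_poly[OF G K hol(2) e2])
  obtain q2 where q2: "\<forall>z\<in>K. norm (inverse z * poly q2 (inverse z) - g2 z) < e / 2"
    by (rule approx_by_inverse_times_poly[OF G K hol(3) e2])
  obtain h where h_hol: "\<And>n. h n holomorphic_on G" and h:
      "uniform_limit K h (\<lambda>z. 0) sequentially"
      "uniform_limit K (\<lambda>n. taylor_op G (a n) (h n)) (\<lambda>z. inverse z * poly q1 (inverse z)) sequentially"
      "uniform_limit K (\<lambda>n. taylor_op G (b n) (h n)) (\<lambda>z. inverse z * poly q2 (inverse z)) sequentially"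
    using steerable_inverse_poly[OF G K a b ratio, of q1 q2] unfolding steerable_def by blast
  define P where "P = [:0, 1:] * p"
  have "\<forall>\<^sub>F n in sequentially. n \<ge> 1 \<and> degree P \<le> a n \<and> degree P \<le> b n \<and>
      (\<forall>z\<in>K. norm (h n z) < e / 2) \<and>
      (\<forall>z\<in>K. norm (taylor_op G (a n) (h n) z - inverse z * poly q1 (inverse z)) < e / 2) \<and>
      (\<forall>z\<in>K. norm (taylor_op G (b n) (h n) z - inverse z * poly q2 (inverse z)) < e / 2)"
    using uniform_limitD[OF h(1) e2] uniform_limitD[OF h(2) e2] uniform_limitD[OF h(3) e2] a b
    unfolding filterlim_at_top dist_norm
    by (intro eventually_conj eventually_ge_at_top) auto
  then obtain n where n: "n \<ge> 1" "degree P \<le> a n" "degree P \<le> b n"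
      "\<forall>z\<in>K. norm (h n z) < e / 2"
      "\<forall>z\<in>K. norm (taylor_op G (a n) (h n) z - inverse z * poly q1 (inverse z)) < e / 2"
      "\<forall>z\<in>K. norm (taylor_op G (b n) (h n) z - inverse z * poly q2 (inverse z)) < e / 2"
    using eventually_happens'[OF sequentially_bot] by blast
  have P_hol: "poly P holomorphic_on G" by (intro holomorphic_intros)
  have P0: "poly P 0 = 0" by (simp add: P_def)
  have T: "taylor_op G m (\<lambda>z. poly P z + h n z) z = taylor_op G m (h n) z"
    if "z \<in> K" "degree P \<le> m" for m z
    using taylor_op_poly[of z G P m] that K
    by (auto simp: taylor_op_add[OF G(1) P_hol h_hol] P0)
  show thesis
  proof (rule that[of n "\<lambda>z. poly P z + h n z"]; (intro ballI)?)
    show "(\<lambda>z. poly P z + h n z) holomorphic_on G" by (intro holomorphic_on_add P_hol h_hol)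
    fix z assume z: "z \<in> K"
    show "norm (poly P z + h n z - f z) < e"
      using norm_triangle_ineq[of "z * poly p z - f z" "h n z"] bspec[OF p z] bspec[OF n(4) z]
      by (simp add: P_def algebra_simps)
    show "norm (taylor_op G (a n) (\<lambda>z. poly P z + h n z) z - g1 z) < e"
      using norm_diff_triangle_less[OF bspec[OF n(5) z] bspec[OF q1 z]] T[OF z n(2)] by simp
    show "norm (taylor_op G (b n) (\<lambda>z. poly P z + h n z) z - g2 z) < e"
      using norm_diff_triangle_less[OF bspec[OF n(6) z] bspec[OF q2 z]] T[OF z n(3)] by simp
  qed (use n in auto)
qed

section \<open>Category argument and universality\<close>

lemma compact_exhaustion:
  fixes G :: "complex set"
  assumes "open G"
  obtains C :: "nat \<Rightarrow> complex set" where "\<forall>n. compact (C n)" "\<forall>n. C n \<subseteq> G"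
    "\<forall>K. compact K \<longrightarrow> K \<subseteq> G \<longrightarrow> (\<exists>N. \<forall>n\<ge>N. K \<subseteq> C n)"
proof (rule open_Union_compact_subsets[OF assms])
  fix C :: "nat \<Rightarrow> complex set"
  assume C: "\<And>n. compact (C n)" "\<And>n. C n \<subseteq> G"
    "\<And>K. \<lbrakk>compact K; K \<subseteq> G\<rbrakk> \<Longrightarrow> \<exists>N. \<forall>n\<ge>N. K \<subseteq> C n"
  show thesis by (rule that[of C]) (intro allI impI C; assumption)+
qed

text \<open>
  Choose inductively triples \<open>(F n, K n, E n)\<close>, standing for the closed neighbourhoods
  \<open>V (S n)\<close> of functions within \<open>E n\<close> of \<open>F n\<close> on \<open>K n\<close>, such that these are nested, the next one lies in \<open>U n\<close>,
  the radii tend to \<open>0\<close> and the compact sets exhaust \<open>G\<close>. Then \<open>F\<close> is uniformly Cauchy on compact subsets,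
  and its limit is holomorphic and belongs to every neighbourhood.
\<close>

lemma hol_topology_Baire:
  fixes U :: "nat \<Rightarrow> (complex \<Rightarrow> complex) set"
  assumes G: "open G" and op: "\<And>n. openin (hol_topology G) (U n)"
    and dense: "\<And>n f K e. f \<in> hol_space G \<Longrightarrow> compact K \<Longrightarrow> K \<subseteq> G \<Longrightarrow> e > 0 \<Longrightarrow> U n \<inter> hol_nbhd G f K e \<noteq> {}"
  obtains f where "f \<in> hol_space G" "\<forall>n. f \<in> U n"
proof -
  obtain C :: "nat \<Rightarrow> complex set" where C_all: "\<forall>n. compact (C n)" "\<forall>n. C n \<subseteq> G"
      "\<forall>K. compact K \<longrightarrow> K \<subseteq> G \<longrightarrow> (\<exists>N. \<forall>n\<ge>N. K \<subseteq> C n)"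
    by (rule compact_exhaustion[OF G])
  note C = C_all[rule_format]
  define ok where "ok = (\<lambda>(f, K, e). f \<in> hol_space G \<and> compact K \<and> K \<subseteq> G \<and> (0 :: real) < e)"
  define V where "V = (\<lambda>(f, K, e :: real). {g \<in> hol_space G. \<forall>z\<in>K. norm (g z - f z) \<le> e})"
  define step where "step = (\<lambda>n s s'. V s' \<subseteq> V s \<inter> U n \<and>
      C n \<subseteq> fst (snd s') \<and> snd (snd s') \<le> (1 / 2) ^ n)"
  have ex: "\<exists>s'. ok s' \<and> step n s s'" if s: "ok s" for n s
  proof -
    obtain f K e where s_eq: "s = (f, K, e)" by (metis prod_cases3)
    have fKe: "f \<in> hol_space G" "compact K" "K \<subseteq> G" "0 < e" using s by (auto simp: ok_def s_eq)
    obtain f' where f': "f' \<in> U n \<inter> hol_nbhd G f K e" using dense[OF fKe] by blast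
    have f'_hol: "f' \<in> hol_space G" using f' by (auto simp: hol_nbhd_def)
    have "openin (hol_topology G) (U n \<inter> hol_nbhd G f K e)"
      by (intro openin_Int op openin_hol_nbhd fKe)
    then obtain L d where L: "compact L" "L \<subseteq> G" "d > (0::real)" "hol_nbhd G f' L d \<subseteq> U n \<inter> hol_nbhd G f K e"
      using f' unfolding openin_hol_topology by blast
    define s' where "s' = (f', L \<union> C n, min (d / 2) ((1 / 2) ^ n))"
    have "ok s'"
      using L f'_hol C(1,2)[of n] fKe by (auto simp: ok_def s'_def intro!: compact_Un)
    moreover have "V s' \<subseteq> hol_nbhd G f' L d"
    proof
      fix g assume g: "g \<in> V s'"
      have "norm (g z - f' z) < d" if "z \<in> L" for z
      proof -
        have "norm (g z - f' z) \<le> d / 2" using g that by (simp add: V_def s'_def)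
        then show ?thesis using L(3) by simp
      qed
      then show "g \<in> hol_nbhd G f' L d" using g by (simp add: V_def s'_def hol_nbhd_def)
    qed
    then have "V s' \<subseteq> U n" "V s' \<subseteq> hol_nbhd G f K e" using L(4) by blast+
    moreover have "hol_nbhd G f K e \<subseteq> V s"
      by (auto simp: s_eq V_def hol_nbhd_def less_imp_le)
    ultimately have "ok s' \<and> V s' \<subseteq> V s \<inter> U n" by blast
    moreover have "C n \<subseteq> fst (snd s') \<and> snd (snd s') \<le> (1 / 2) ^ n"
      by (auto simp: s'_def s_eq)
    ultimately show ?thesis unfolding step_def by blast
  qed
  have "ok (\<lambda>z. 0, {}, 1)" by (simp add: ok_def hol_space_def)
  then have "\<exists>S. \<forall>n. ok (S n) \<and> step n (S n) (S (Suc n))"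
    by (intro dependent_nat_choice ex) blast
  then obtain S where S: "\<And>n. ok (S n)" "\<And>n. step n (S n) (S (Suc n))" by blast
  define F K E where "F n = fst (S n)" and "K n = fst (snd (S n))" and "E n = snd (snd (S n))" for n
  have S_eq: "S n = (F n, K n, E n)" for n by (simp add: F_def K_def E_def)
  have okS: "F n \<in> hol_space G" "compact (K n)" "K n \<subseteq> G" "0 < E n" for n
    using S(1)[of n] by (auto simp: ok_def S_eq)
  have stepS: "V (S (Suc n)) \<subseteq> V (S n)" "V (S (Suc n)) \<subseteq> U n" "C n \<subseteq> K (Suc n)"
      "E (Suc n) \<le> (1 / 2) ^ n" for n
    using S(2)[of n] by (auto simp: step_def K_def E_def)
  have V_anti: "V (S m) \<subseteq> V (S n)" if "n \<le> m" for m n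
    by (rule lift_Suc_antimono_le[of "\<lambda>k. V (S k)", OF stepS(1) that])
  have F_V: "F m \<in> V (S n)" if "n \<le> m" for m n
    using V_anti[OF that] okS[of m] by (auto simp: V_def S_eq)
  have F_close: "norm (F m z - F n z) \<le> E n" if "n \<le> m" "z \<in> K n" for m n z
    using F_V[OF that(1)] that(2) by (auto simp: V_def S_eq)
  have E_lim: "(\<lambda>n. E (Suc n)) \<longlonglongrightarrow> 0"
    by (rule tendsto_sandwich[OF _ _ tendsto_const LIMSEQ_realpow_zero[of "1 / 2"]])
       (use okS(4) stepS(4) in \<open>auto intro!: always_eventually less_imp_le\<close>)
  define g where "g = cut G (\<lambda>z. lim (\<lambda>n. F n z))"
  have ulim: "uniform_limit L F g sequentially" if L: "compact L" "L \<subseteq> G" for L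
  proof -
    obtain N where N: "\<forall>n\<ge>N. L \<subseteq> C n" using C(3)[OF L] by blast
    then have LK: "L \<subseteq> K (Suc n)" if "n \<ge> N" for n
      using stepS(3)[of n] that by blast
    have "uniformly_Cauchy_on L F"
      unfolding uniformly_Cauchy_on_def
    proof (intro allI impI)
      fix e :: real assume "e > 0"
      then have "\<forall>\<^sub>F n in sequentially. E (Suc n) < e / 2"
        by (intro order_tendstoD(2)[OF E_lim]) simp
      then obtain M where "\<forall>n\<ge>M. E (Suc n) < e / 2" unfolding eventually_sequentially by blast
      then obtain n where n: "n \<ge> N" "E (Suc n) < e / 2" by (meson max.cobounded1 max.cobounded2)
      have "dist (F p z) (F q z) < e" if "z \<in> L" "p \<ge> Suc n" "q \<ge> Suc n" for z p q
      proof -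
        have "z \<in> K (Suc n)" using LK[OF n(1)] that by blast
        then have "norm (F p z - F (Suc n) z) \<le> E (Suc n)" "norm (F q z - F (Suc n) z) \<le> E (Suc n)"
          using F_close that by auto
        then have "dist (F p z) (F (Suc n) z) < e / 2" "dist (F q z) (F (Suc n) z) < e / 2"
          using n(2) by (auto simp: dist_norm)
        then show ?thesis by (rule dist_triangle_half_l)
      qed
      then show "\<exists>M. \<forall>z\<in>L. \<forall>p\<ge>M. \<forall>q\<ge>M. dist (F p z) (F q z) < e" by blast
    qed
    then obtain l where l: "uniform_limit L F l sequentially"
      using Cauchy_uniformly_convergent uniformly_convergent_on_def by blast
    have "l z = g z" if "z \<in> L" for z
      using tendsto_uniform_limitI[OF l that] that L(2) by (auto simp: g_def cut_def limI)
    then show ?thesis using l uniform_limit_cong'[of L F F l g] by simp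
  qed
  have "g holomorphic_on G"
  proof (rule holomorphic_uniform_sequence[OF G])
    show "F n holomorphic_on G" for n using okS(1)[of n] by (simp add: hol_space_def)
    fix z assume "z \<in> G"
    then obtain d where "d > 0" "cball z d \<subseteq> G" using G open_contains_cball_eq by blast
    then show "\<exists>d. 0 < d \<and> cball z d \<subseteq> G \<and> uniform_limit (cball z d) F g sequentially"
      by (intro exI[of _ d] conjI ulim compact_cball)
  qed
  then have g: "g \<in> hol_space G" by (auto simp: hol_space_def g_def cut_def)
  have "g \<in> V (S n)" for n
  proof -
    have "norm (g z - F n z) \<le> E n" if z: "z \<in> K n" for z
    proof (rule tendsto_upperbound)
      have "(\<lambda>m. F m z) \<longlonglongrightarrow> g z"
        using tendsto_uniform_limitI[OF ulim[of "K n"] z] okS by blast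
      then show "(\<lambda>m. norm (F m z - F n z)) \<longlonglongrightarrow> norm (g z - F n z)"
        by (intro tendsto_intros)
      show "\<forall>\<^sub>F m in sequentially. norm (F m z - F n z) \<le> E n"
        using F_close z by (intro eventually_sequentiallyI)
    qed simp
    then show ?thesis using g by (auto simp: V_def S_eq)
  qed
  then have "\<forall>n. g \<in> U n" using stepS(2) by blast
  with g show thesis by (rule that)
qed

lemma continuous_map_taylor_op:
  assumes G: "open G"
  shows "continuous_map (hol_topology G) (hol_topology G) (taylor_op G n)"
  unfolding continuous_map_def topspace_hol_topology
proof (intro conjI allI impI)
  have hol: "f holomorphic_on G" if "f \<in> hol_space G" for f using that by (simp add: hol_space_def)
  then show "taylor_op G n \<in> hol_space G \<rightarrow> hol_space G"
    using taylor_op_in_hol_space[OF G] by blast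
  fix U assume U: "openin (hol_topology G) U"
  show "openin (hol_topology G) {f \<in> hol_space G. taylor_op G n f \<in> U}"
    unfolding openin_hol_topology
  proof (intro conjI ballI)
    fix f assume "f \<in> {f \<in> hol_space G. taylor_op G n f \<in> U}"
    then have f: "f \<in> hol_space G" "taylor_op G n f \<in> U" by auto
    then obtain K e where K: "compact K" "K \<subseteq> G" "e > (0::real)" "hol_nbhd G (taylor_op G n f) K e \<subseteq> U"
      using U unfolding openin_hol_topology by blast
    obtain K' A where K': "compact K'" "K \<subseteq> K'" "K' \<subseteq> G" and A: "A > 0"
      and bound: "\<forall>f B n. f holomorphic_on G \<longrightarrow> (\<forall>z\<in>K'. norm (f z) \<le> B) \<longrightarrow>
       (\<forall>\<zeta>\<in>K. norm (taylor_op G n f \<zeta>) \<le> B * A ^ n)"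
      by (rule taylor_op_compact_bound[OF G K(1,2)])
    define d where "d = e / (2 * A ^ n)"
    have d: "d > 0" "d * A ^ n < e" using K(3) A by (simp_all add: d_def)
    have "taylor_op G n g \<in> U" if g: "g \<in> hol_nbhd G f K' d" for g
    proof -
      have g_hol: "g \<in> hol_space G" and gd: "\<forall>z\<in>K'. norm (g z - f z) \<le> d"
        using g by (auto simp: hol_nbhd_def less_imp_le)
      have "(\<lambda>z. g z - f z) holomorphic_on G"
        using hol[OF f(1)] hol[OF g_hol] by (intro holomorphic_intros)
      then have "\<forall>z\<in>K. norm (taylor_op G n (\<lambda>z. g z - f z) z) \<le> d * A ^ n"
        using bound gd by blast
      then have "\<forall>z\<in>K. norm (taylor_op G n g z - taylor_op G n f z) < e"
        using d(2) unfolding taylor_op_diff[OF G hol[OF g_hol] hol[OF f(1)]] by force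
      then have "taylor_op G n g \<in> hol_nbhd G (taylor_op G n f) K e"
        using taylor_op_in_hol_space[OF G hol[OF g_hol]] by (simp add: hol_nbhd_def)
      then show ?thesis using K(4) by blast
    qed
    then have "hol_nbhd G f K' d \<subseteq> {f \<in> hol_space G. taylor_op G n f \<in> U}"
      by (auto simp: hol_nbhd_def)
    then show "\<exists>K e. compact K \<and> K \<subseteq> G \<and> 0 < e \<and> hol_nbhd G f K e \<subseteq> {f \<in> hol_space G. taylor_op G n f \<in> U}"
      using K' d(1) by blast
  qed blast
qed

lemma continuous_linear_operator_taylor_pair:
  assumes G: "open G"
  shows "continuous_linear_operator fun_scale pair_scale
           (hol_topology G) (prod_topology (hol_topology G) (hol_topology G))
           (\<lambda>f. (taylor_op G m f, taylor_op G n f))"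
proof -
  have hol: "f holomorphic_on G" if "f \<in> hol_space G" for f using that by (simp add: hol_space_def)
  have "taylor_op G k (f + g) = taylor_op G k f + taylor_op G k g"
    if "f \<in> hol_space G" "g \<in> hol_space G" for k f g
    using taylor_op_add[OF G hol[OF that(1)] hol[OF that(2)]] by (simp add: plus_fun_def)
  moreover have "taylor_op G k (fun_scale c f) = fun_scale c (taylor_op G k f)"
    if "f \<in> hol_space G" for k c f
    using taylor_op_cmult[OF G hol[OF that]] by (simp add: fun_scale_def)
  ultimately show ?thesis
    unfolding continuous_linear_operator_def topspace_hol_topology
    by (auto simp: continuous_map_pairwise o_def continuous_map_taylor_op[OF G] pair_scale_def)
qed

text \<open>
  Perturb the coefficients one at a time. With \<open>D\<close> countable this makes the polynomials with
  coefficients in \<open>D\<close> a countable substitute for all polynomials.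
\<close>

lemma poly_coeff_perturbation:
  fixes D :: "complex set"
  assumes D: "\<And>U. open U \<Longrightarrow> U \<noteq> {} \<Longrightarrow> \<exists>y\<in>D. y \<in> U" and K: "compact K" and "e > 0"
  shows "\<exists>ds\<in>lists D. \<forall>z\<in>K. norm (poly p z - poly (Poly ds) z) < e"
  using \<open>e > 0\<close>
proof (induction p arbitrary: e)
  case 0
  then show ?case by (intro bexI[of _ "[]"]) auto
next
  case (pCons c p)
  obtain R where R: "R > 0" "\<And>z. z \<in> K \<Longrightarrow> norm z \<le> R"
    using compact_imp_bounded[OF K] unfolding bounded_pos by blast
  obtain ds where ds: "ds \<in> lists D" "\<forall>z\<in>K. norm (poly p z - poly (Poly ds) z) < e / (2 * R)"
    using pCons.IH[of "e / (2 * R)"] R(1) pCons.prems by auto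
  obtain d where d: "d \<in> D" "d \<in> ball c (e / 2)"
    using D[of "ball c (e / 2)"] pCons.prems by auto
  have "norm (poly (pCons c p) z - poly (Poly (d # ds)) z) < e" if z: "z \<in> K" for z
  proof -
    have "norm (poly (pCons c p) z - poly (Poly (d # ds)) z)
        = norm ((c - d) + z * (poly p z - poly (Poly ds) z))"
      by (simp add: algebra_simps)
    also have "\<dots> \<le> norm (c - d) + norm z * norm (poly p z - poly (Poly ds) z)"
      using norm_triangle_ineq[of "c - d" "z * (poly p z - poly (Poly ds) z)"] by (simp add: norm_mult)
    also have "\<dots> \<le> norm (c - d) + R * (e / (2 * R))"
      by (intro add_left_mono mult_mono R z less_imp_le[OF bspec[OF ds(2)]]) (use R in auto)
    also have "\<dots> < e" using d(2) R(1) by (simp add: dist_norm)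
    finally show ?thesis .
  qed
  then show ?case using ds(1) d(1) by (intro bexI[of _ "d # ds"]) auto
qed

text \<open>
  The set \<open>W (ds, ds', j)\<close> consists of the functions that some pair of operators of index at least \<open>1\<close> sends
  into the basic neighbourhood given by the centres \<open>ds\<close>, \<open>ds'\<close> and by the \<open>j\<close>-th compact set and radius.
  It is open by continuity and dense by simultaneous approximation. A function in all of these countably
  many sets has a dense orbit, since Runge's theorem puts such a neighbourhood inside any nonempty open set.
\<close>

theorem theorem1p1:
  fixes G :: "complex set" and l1 l2 :: "nat \<Rightarrow> nat"
  assumes "open G" and "connected G" and "G \<noteq> {}" and "simply_connected G"
    and "0 \<notin> G"
    and "\<And>n. n \<ge> 1 \<Longrightarrow> l1 n > 0" and "\<And>n. n \<ge> 1 \<Longrightarrow> l2 n > 0"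
    and "filterlim l1 at_top sequentially"
    and "filterlim (\<lambda>n. real (l2 n) / real (l1 n)) at_top sequentially"
  shows "universal_sequence fun_scale pair_scale
           (hol_topology G) (prod_topology (hol_topology G) (hol_topology G))
           (\<lambda>n f. (taylor_op G (l1 n) f, taylor_op G (l2 n) f))"
proof -
  note G = assms(1,4,5)
  have l2: "filterlim l2 at_top sequentially"
  proof (rule filterlim_at_top_mono[OF assms(8)])
    have "\<forall>\<^sub>F n in sequentially. real (l2 n) / real (l1 n) \<ge> 1"
      using assms(9) by (simp add: filterlim_at_top)
    then show "\<forall>\<^sub>F n in sequentially. l1 n \<le> l2 n"
      by eventually_elim (auto simp: divide_simps split: if_splits)
  qed
  obtain D :: "complex set" where D: "countable D" "\<And>U. open U \<Longrightarrow> U \<noteq> {} \<Longrightarrow> \<exists>y\<in>D. y \<in> U"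
    using countable_dense_exists by blast
  obtain C :: "nat \<Rightarrow> complex set" where C_all: "\<forall>n. compact (C n)" "\<forall>n. C n \<subseteq> G"
      "\<forall>K. compact K \<longrightarrow> K \<subseteq> G \<longrightarrow> (\<exists>N. \<forall>n\<ge>N. K \<subseteq> C n)"
    by (rule compact_exhaustion[OF G(1)])
  note C = C_all[rule_format]
  define N where "N = (\<lambda>ds (j::nat). hol_nbhd G (cut G (poly (Poly ds))) (C j) (1 / Suc j))"
  define I where "I = lists D \<times> lists D \<times> (UNIV :: nat set)"
  define W where "W = (\<lambda>(ds, ds', j). \<Union>n\<in>{1..}. {f \<in> hol_space G. taylor_op G (l1 n) f \<in> N ds j} \<inter>
      {f \<in> hol_space G. taylor_op G (l2 n) f \<in> N ds' j})"
  have I: "countable I" "I \<noteq> {}" using D(1) by (auto simp: I_def intro!: exI[of _ "[]"])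
  have cut_poly: "cut G (poly p) \<in> hol_space G" for p
    by (intro cut_in_hol_space holomorphic_intros)
  have N_open: "openin (hol_topology G) (N ds j)" for ds j
    unfolding N_def by (intro openin_hol_nbhd cut_poly C)
  have preimage_open: "openin (hol_topology G) {f \<in> hol_space G. taylor_op G n f \<in> N ds j}" for n ds j
    using openin_continuous_map_preimage[OF continuous_map_taylor_op[OF G(1)] N_open]
    by (simp add: topspace_hol_topology)
  have W_open: "openin (hol_topology G) (W i)" for i
    unfolding W_def by (auto simp: case_prod_unfold intro!: preimage_open)
  have W_dense: "W i \<inter> hol_nbhd G f K e \<noteq> {}"
    if f: "f \<in> hol_space G" and K: "compact K" "K \<subseteq> G" and e: "e > 0" for i f K e
  proof -
    obtain ds ds' j where i: "i = (ds, ds', j)" by (metis prod_cases3)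
    have KC: "compact (K \<union> C j)" "K \<union> C j \<subseteq> G" using K C by auto
    have f_hol: "f holomorphic_on G" using f by (simp add: hol_space_def)
    have poly_hol: "poly p holomorphic_on G" for p by (intro holomorphic_intros)
    have "min e (1 / Suc j) > 0" using e by simp
    then obtain n h where n: "n \<ge> 1" and h: "h holomorphic_on G"
      and close: "\<forall>z\<in>K \<union> C j. norm (h z - f z) < min e (1 / Suc j)"
        "\<forall>z\<in>K \<union> C j. norm (taylor_op G (l1 n) h z - poly (Poly ds) z) < min e (1 / Suc j)"
        "\<forall>z\<in>K \<union> C j. norm (taylor_op G (l2 n) h z - poly (Poly ds') z) < min e (1 / Suc j)"
      by (rule simultaneous_approximation[OF G KC assms(8) l2 assms(9) f_hol poly_hol poly_hol])
    have h': "cut G h \<in> hol_space G" by (rule cut_in_hol_space[OF h])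
    have z_G: "z \<in> K \<Longrightarrow> z \<in> G" "z \<in> C j \<Longrightarrow> z \<in> G" for z using KC by auto
    have "cut G h \<in> hol_nbhd G f K e"
      using h' close(1) z_G by (auto simp: hol_nbhd_def cut_def)
    moreover have "taylor_op G (l1 n) (cut G h) \<in> N ds j" "taylor_op G (l2 n) (cut G h) \<in> N ds' j"
      using taylor_op_in_hol_space[OF G(1) h] close(2,3) z_G
      unfolding taylor_op_cut[OF G(1) h] by (auto simp: N_def hol_nbhd_def cut_def)
    then have "cut G h \<in> W i" using n h' by (auto simp: W_def i)
    ultimately show ?thesis by blast
  qed
  obtain x where x: "x \<in> hol_space G" "\<forall>k. x \<in> W (from_nat_into I k)"
    by (rule hol_topology_Baire[OF G(1), of "\<lambda>k. W (from_nat_into I k)"]) (use W_open W_dense in auto)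
  then have xW: "x \<in> W i" if "i \<in> I" for i
    using from_nat_into_surj[OF I(1) that] by metis
  let ?T = "\<lambda>n f. (taylor_op G (l1 n) f, taylor_op G (l2 n) f)"
  let ?H = "hol_topology G"
  have "prod_topology ?H ?H closure_of {?T n x | n. n \<ge> 1} = topspace (prod_topology ?H ?H)"
  proof (intro equalityI closure_of_subset_topspace subsetI)
    fix y assume y: "y \<in> topspace (prod_topology ?H ?H)"
    obtain g1 g2 where y_eq: "y = (g1, g2)" by (metis surj_pair)
    have g: "g1 \<in> hol_space G" "g2 \<in> hol_space G"
      using y by (auto simp: y_eq topspace_hol_topology)
    show "y \<in> prod_topology ?H ?H closure_of {?T n x | n. n \<ge> 1}"
      unfolding in_closure_of
    proof (intro conjI y allI impI)
      fix O' assume "y \<in> O' \<and> openin (prod_topology ?H ?H) O'"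
      then obtain U1 U2 where U: "openin ?H U1" "openin ?H U2" "g1 \<in> U1" "g2 \<in> U2" "U1 \<times> U2 \<subseteq> O'"
        unfolding openin_prod_topology_alt y_eq by blast
      obtain K1 e1 where 1: "compact K1" "K1 \<subseteq> G" "e1 > (0::real)" "hol_nbhd G g1 K1 e1 \<subseteq> U1"
        using U(1,3) unfolding openin_hol_topology by blast
      obtain K2 e2 where 2: "compact K2" "K2 \<subseteq> G" "e2 > (0::real)" "hol_nbhd G g2 K2 e2 \<subseteq> U2"
        using U(2,4) unfolding openin_hol_topology by blast
      define K e where "K = K1 \<union> K2" and "e = min e1 e2"
      have K: "compact K" "K \<subseteq> G" and e: "e > 0" using 1 2 by (auto simp: K_def e_def)
      obtain j0 where j0: "\<forall>n\<ge>j0. K \<subseteq> C n" using C(3)[OF K] by blast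
      obtain j1 where j1: "1 / real (Suc j1) < e / 2"
        using nat_approx_posE[of "e / 2"] e by auto
      define j where "j = max j0 j1"
      have "1 / real (Suc j) \<le> 1 / real (Suc j1)" by (intro divide_left_mono) (auto simp: j_def)
      then have j: "K \<subseteq> C j" "1 / real (Suc j) < e / 2" using j0 j1 by (auto simp: j_def)
      have approx: "\<exists>ds\<in>lists D. N ds j \<subseteq> hol_nbhd G g K e" if g: "g \<in> hol_space G" for g
      proof -
        have "poly_approx K g"
          by (rule runge_simply_connected[OF G(1,2) _ K]) (use G(3) g in \<open>auto simp: hol_space_def\<close>)
        then obtain p where p: "\<forall>z\<in>K. norm (g z - poly p z) < e / 4"
          using e unfolding poly_approx_def by (meson divide_pos_pos zero_less_numeral)
        obtain ds where ds: "ds \<in> lists D" "\<forall>z\<in>K. norm (poly p z - poly (Poly ds) z) < e / 4"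
          using poly_coeff_perturbation[OF D(2) K(1), of "e / 4" p] e by auto
        have "h \<in> hol_nbhd G g K e" if h: "h \<in> N ds j" for h
        proof -
          have "norm (h z - g z) < e" if z: "z \<in> K" for z
          proof -
            have "norm (h z - poly (Poly ds) z) < e / 2"
              using h j z K(2) by (force simp: N_def hol_nbhd_def cut_def)
            moreover have "norm (poly (Poly ds) z - g z) < e / 4 + e / 4"
              using norm_diff_triangle_less[of "poly (Poly ds) z" "poly p z" "e / 4" "g z" "e / 4"] ds(2) p z
              by (simp add: norm_minus_commute)
            ultimately show ?thesis
              using norm_diff_triangle_less[of "h z" "poly (Poly ds) z" "e / 2" "g z" "e / 2"] by simp
          qed
          then show ?thesis using h by (simp add: N_def hol_nbhd_def)
        qed
        then show ?thesis using ds(1) by blast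
      qed
      obtain ds where ds: "ds \<in> lists D" "N ds j \<subseteq> hol_nbhd G g1 K e" using approx[OF g(1)] by blast
      obtain ds' where ds': "ds' \<in> lists D" "N ds' j \<subseteq> hol_nbhd G g2 K e" using approx[OF g(2)] by blast
      have "hol_nbhd G g1 K e \<subseteq> U1" "hol_nbhd G g2 K e \<subseteq> U2"
        using 1(4) 2(4) by (auto simp: K_def e_def hol_nbhd_def)
      moreover have "x \<in> W (ds, ds', j)" using ds(1) ds'(1) by (intro xW) (simp add: I_def)
      then obtain n where "n \<ge> 1" "taylor_op G (l1 n) x \<in> N ds j" "taylor_op G (l2 n) x \<in> N ds' j"
        by (auto simp: W_def)
      ultimately have "?T n x \<in> O'" using ds(2) ds'(2) U(5) by blast
      then show "\<exists>y. y \<in> {?T n x | n. n \<ge> 1} \<and> y \<in> O'" using \<open>n \<ge> 1\<close> by blast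
    qed
  qed
  then show ?thesis
    unfolding universal_sequence_def topspace_hol_topology
    using continuous_linear_operator_taylor_pair[OF G(1)] x(1) by blast
qed

end
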